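(* For every integer $n \geq 1$, $$P_n(x) = \sum_{T \in \mathcal{T}_n^e} 2^{\mathrm{fr}(T)-1-\max(T)}\, x^{\max(T)}.$$
   Context: The polynomials $P_n(x)$ are defined by $P_1(x)=1$ and $P_{n+1}(x) = \frac{(x+2)(x+1)}{2}P_n(x+2) - \frac{x(x-1)}{2}P_n(x)$ for $n\ge 1$. For integers $a\le b$, $[a,b]=\{a,\dots,b\}$ and $[n]=[1,n]$. Fix $n\ge1$. Consider a grid with $n$ columns numbered $1,\dots,n$ from left to right and $2n$ rows numbered $1,\dots,2n$ from bottom to top; $(j:i)$ denotes the box in column $j$ and row $i$ (and also a point placed in that box). $\mathcal{T}_n^e$ is the set of placements of $2n$ points in this grid such that every row contains exactly one point, every column contains exactly two points, and every point $(j:i)$ satisfies $i\ge j$. For $T\in\mathcal{T}_n^e$ and $i\in[2n]$, $p_i^T$ denotes the unique point of row $i$. In each column, the point with the larger row index is the upper point and the other is the lower point. A point $(j:i)$ of $T$ is free if $i \ge 2n+1-j$; $\mathrm{fr}(T)$ is the number of free points of $T$. Paths. For a point $p_0$ of $T$ define $p_0,p_1,\dots$ as follows, writing $p_k=(j_k:i_k)$: if $j_k=n$ then $p_{k+1}=p_k$; if $j_k<n$ and $p_k$ is the upper point of its column, then $p_{k+1}=p^T_{2n-j_k}$; if $j_k<n$ and $p_k$ is the lower point of its column, then $p_{k+1}=p^T_{j_k}$. For $i\in[2n]$, $S_T(i)$ is the finite subsequence $(p_{k_0},\dots,p_{k_f})$ of the sequence starting at $p_0=p_i^T$ defined by $k_0=0$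 and, as long as $j_{k_q}<\max_{k\ge0} j_k$, $k_{q+1}=\min\{k>k_q : j_k>j_{k_q}\}$; the sequence stops at the first $q=f$ with $j_{k_q}=\max_{k\ge0}j_k$. Let $B(T)=S_T(n)$ and $R(T)=S_T(2n)$, and let $\mathrm{b}(T)+1$ and $\mathrm{r}(T)+1$ be their numbers of elements. Roots. For a point $(j:i)$ of $T$, define $i_0=i$ and, for $k\ge0$: if $i_k\in[j,2n-j]\cup\{2n\}$ then $i_{k+1}=i_k$; if $i_k\in[2n-j+1,2n-1]$ then $i_{k+1}$ is the row of the upper point of column $2n-i_k$; if $i_k\in[1,j-1]$ then $i_{k+1}$ is the row of the lower point of column $i_k$. This sequence is eventually constant; its eventual value is denoted $\mathrm{root}_T(j:i)$. $\mathcal{G}(T)$ is the set of free points $p=(j:i)$ of $T$ such that the other point of column $j$ belongs to $B(T)$ and $\mathrm{root}_T(j:i)=j$; $\mathrm{g}(T)=|\mathcal{G}(T)|$. Finally $\max(T)=\mathrm{b}(T)+\mathrm{r}(T)+\mathrm{g}(T)$. *)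

theory Defs
  imports "HOL-Computational_Algebra.Polynomial"
begin

(* The value at index 0 is junk: the sequence starts at index 1. *)
fun P_poly :: "nat \<Rightarrow> rat poly" where
  "P_poly 0 = 0"
| "P_poly (Suc 0) = 1"
| "P_poly (Suc (Suc n)) =
     smult (1/2) ([:2, 1:] * [:1, 1:]) * pcompose (P_poly (Suc n)) [:2, 1:]
     - smult (1/2) ([:0, 1:] * [:-1, 1:]) * P_poly (Suc n)"

(* The box, or point, in column j and row i is the pair (j, i); a placement is the
   set of its points. *)
type_synonym point = "nat \<times> nat"

definition placements :: "nat \<Rightarrow> point set set" where
  "placements n = {T. T \<subseteq> {1..n} \<times> {1..2*n}
     \<and> (\<forall>i\<in>{1..2*n}. \<exists>!p. p \<in> T \<and> snd p = i)
     \<and> (\<forall>j\<in>{1..n}. card {p \<in> T. fst p = j} = 2)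
     \<and> (\<forall>(j, i)\<in>T. i \<ge> j)}"

definition row_point :: "point set \<Rightarrow> nat \<Rightarrow> point" where
  "row_point T i = (THE p. p \<in> T \<and> snd p = i)"

definition upper_row :: "point set \<Rightarrow> nat \<Rightarrow> nat" where
  "upper_row T j = Max {i. (j, i) \<in> T}"

definition lower_row :: "point set \<Rightarrow> nat \<Rightarrow> nat" where
  "lower_row T j = Min {i. (j, i) \<in> T}"

definition free_points :: "nat \<Rightarrow> point set \<Rightarrow> point set" where
  "free_points n T = {(j, i) \<in> T. i \<ge> 2*n + 1 - j}"

definition fr_stat :: "nat \<Rightarrow> point set \<Rightarrow> nat" where
  "fr_stat n T = card (free_points n T)"

definition next_point :: "nat \<Rightarrow> point set \<Rightarrow> point \<Rightarrow> point" where
  "next_point n T = (\<lambda>(j, i).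
     if j = n then (j, i)
     else if i = upper_row T j then row_point T (2*n - j)
     else row_point T j)"

definition path :: "nat \<Rightarrow> point set \<Rightarrow> point \<Rightarrow> nat \<Rightarrow> point" where
  "path n T p k = (next_point n T ^^ k) p"

(* The indices of the successive strict column records of a path c. Only the indices up
   to the first one that attains the maximal column are meaningful: past it LEAST ranges
   over an empty set. *)
primrec record_index :: "(nat \<Rightarrow> point) \<Rightarrow> nat \<Rightarrow> nat" where
  "record_index c 0 = 0"
| "record_index c (Suc q) =
     (LEAST k. k > record_index c q \<and> fst (c k) > fst (c (record_index c q)))"

definition last_record :: "(nat \<Rightarrow> point) \<Rightarrow> nat" where
  "last_record c = (LEAST q. fst (c (record_index c q)) = Max (range (\<lambda>k. fst (c k))))"

definition S_seq :: "nat \<Rightarrow> point set \<Rightarrow> nat \<Rightarrow> point list" where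
  "S_seq n T i = (let c = path n T (row_point T i)
     in map (\<lambda>q. c (record_index c q)) [0..<Suc (last_record c)])"

definition B_seq :: "nat \<Rightarrow> point set \<Rightarrow> point list" where
  "B_seq n T = S_seq n T n"

definition R_seq :: "nat \<Rightarrow> point set \<Rightarrow> point list" where
  "R_seq n T = S_seq n T (2*n)"

(* B_seq and R_seq are nonempty, so the subtractions below do not truncate. *)
definition b_stat :: "nat \<Rightarrow> point set \<Rightarrow> nat" where
  "b_stat n T = length (B_seq n T) - 1"

definition r_stat :: "nat \<Rightarrow> point set \<Rightarrow> nat" where
  "r_stat n T = length (R_seq n T) - 1"

definition root_step :: "nat \<Rightarrow> point set \<Rightarrow> nat \<Rightarrow> nat \<Rightarrow> nat" where
  "root_step n T j i =
     (if i \<in> {j..2*n - j} \<union> {2*n} then i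
      else if i \<in> {2*n - j + 1..2*n - 1} then upper_row T (2*n - i)
      else lower_row T i)"

definition root_of :: "nat \<Rightarrow> point set \<Rightarrow> point \<Rightarrow> nat" where
  "root_of n T = (\<lambda>(j, i). THE v. \<exists>K. \<forall>k\<ge>K. (root_step n T j ^^ k) i = v)"

definition G_points :: "nat \<Rightarrow> point set \<Rightarrow> point set" where
  "G_points n T = {(j, i) \<in> free_points n T.
     (\<exists>i'. i' \<noteq> i \<and> (j, i') \<in> T \<and> (j, i') \<in> set (B_seq n T)) \<and> root_of n T (j, i) = j}"

definition g_stat :: "nat \<Rightarrow> point set \<Rightarrow> nat" where
  "g_stat n T = card (G_points n T)"

definition max_stat :: "nat \<Rightarrow> point set \<Rightarrow> nat" where
  "max_stat n T = b_stat n T + r_stat n T + g_stat n T"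

end

theory Submission
  imports Defs "HOL-Combinatorics.Transposition"
begin

text \<open>
  Follow the steps of \<^term>\<open>root_step\<close> through the columns before \<open>c\<close>: this
  matches the rows not used by those columns with the sources \<open>[c, 2n - c] \<union> {2n}\<close>. Replacing
  the two rows of each column \<open>c < n\<close> by their sources turns a placement into a code, in which column
  \<open>c\<close> picks any two sources, subject only to source \<open>c\<close> being picked by a column up to \<open>c\<close>.
  A point lies in \<open>B(T)\<close> or \<open>R(T)\<close> iff its source is \<open>n\<close> or \<open>2n\<close>, and apart from the point in row \<open>2n\<close>
  the free points are counted by the sources \<open>2n - c\<close> that no column up to \<open>c\<close> picks. Hence fr and max
  are sums of local terms of the code, and codes may be relabelled freely.

  Let \<open>H n m y\<close> be the weighted sum over the first \<open>m < n\<close> columns of codes, with \<open>x = 2y\<close>. Adding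
  column \<open>c = m + 1\<close>, with the four cases whether \<open>c\<close> and \<open>2n - c\<close> were picked before, and using the
  symmetry that exchanges these two sources, gives
  \<open>H n (m + 1) y = (z + 1) (2z + 1) H n m y - z (2z - 1) H (n - 1) m y\<close> for \<open>z = y + n - m - 2\<close>. This is the
  defining recurrence of \<open>P_poly\<close>, so \<open>H n m y\<close> is the value of \<open>P_poly (m + 1)\<close> at \<open>2 (y + n - m - 1)\<close>.
\<close>

subsection \<open>Codes and the recurrence\<close>

text \<open>These are the rows at which \<open>root_step\<close> for column \<open>c\<close> stops.
  For \<open>c = n\<close> only \<open>n\<close> and \<open>2n\<close> remain, so these two sources
  lie in \<open>src n c\<close> for every column.\<close>

definition src :: "nat \<Rightarrow> nat \<Rightarrow> nat set" where
  "src n c = {c..2 * n - c} \<union> {2 * n}"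

lemma finite_src [simp]: "finite (src n c)"
  by (simp add: src_def)

text \<open>The head of a code belongs to the last column.\<close>

primrec codes :: "nat \<Rightarrow> nat \<Rightarrow> nat set list set" where
  "codes n 0 = {[]}"
| "codes n (Suc m) = {p # xs | p xs. xs \<in> codes n m \<and> p \<subseteq> src n (Suc m) \<and> card p = 2
     \<and> Suc m \<in> p \<union> \<Union> (set xs)}"

text \<open>The three terms are the shares of column \<open>c\<close> in b, r and g;
  \<open>U\<close> holds the sources picked by earlier columns. The condition
  \<open>c \<in> U\<close> stands for freeness: if row \<open>c\<close> is already taken, the point
  with source \<open>c\<close> has to lie above row \<open>2n - c\<close>.\<close>

definition col_stat :: "nat \<Rightarrow> nat \<Rightarrow> nat set \<Rightarrow> nat set \<Rightarrow> nat" where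
  "col_stat n c U p = of_bool (n \<in> p) + of_bool (2 * n \<in> p) + of_bool (p = {n, c} \<and> c \<in> U)"

text \<open>With \<open>y = x / 2\<close> the summand \<open>2 ^ (fr - 1 - max) * x ^ max\<close>
  becomes \<open>2 ^ (fr - 1) * y ^ max\<close>. Each source \<open>2n - c\<close> still unpicked
  after column \<open>c\<close> stands for one free point and gives the factor 2.\<close>

primrec wt :: "nat \<Rightarrow> rat \<Rightarrow> nat set list \<Rightarrow> rat" where
  "wt n y [] = 1"
| "wt n y (p # xs) = wt n y xs
     * ((if 2 * n - Suc (length xs) \<in> p \<union> \<Union> (set xs) then 1 else 2)
        * y ^ col_stat n (Suc (length xs)) (\<Union> (set xs)) p)"

definition code_sum :: "nat \<Rightarrow> nat \<Rightarrow> rat \<Rightarrow> rat" where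
  "code_sum n m y = (\<Sum>xs\<in>codes n m. wt n y xs)"

lemma codes_SucE:
  assumes "xs \<in> codes n (Suc m)"
  obtains p ys where "xs = p # ys" "ys \<in> codes n m" "p \<subseteq> src n (Suc m)" "card p = 2"
    "Suc m \<in> p \<union> \<Union> (set ys)"
  using assms by auto

lemma Cons_in_codes: "p # ys \<in> codes n (Suc m) \<longleftrightarrow>
    ys \<in> codes n m \<and> p \<subseteq> src n (Suc m) \<and> card p = 2 \<and> Suc m \<in> p \<union> \<Union> (set ys)"
  by simp

lemma length_codes: "xs \<in> codes n m \<Longrightarrow> length xs = m"
  by (induction m arbitrary: xs) auto

lemma src_antimono: "c \<le> c' \<Longrightarrow> src n c' \<subseteq> src n c"
  by (auto simp: src_def)

lemma codes_subset: "xs \<in> codes n m \<Longrightarrow> \<Union> (set xs) \<subseteq> src n 1"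
proof (induction m arbitrary: xs)
  case (Suc m)
  then obtain p ys where "xs = p # ys" "ys \<in> codes n m" "p \<subseteq> src n (Suc m)" by auto
  then show ?case using Suc.IH[of ys] src_antimono[of 1 "Suc m" n] by simp
qed simp

abbreviation pairs :: "'a set \<Rightarrow> 'a set set" where
  "pairs A \<equiv> {p. p \<subseteq> A \<and> card p = 2}"

lemma finite_codes [simp]: "finite (codes n m)"
proof (induction m)
  case (Suc m)
  have "codes n (Suc m) \<subseteq> case_prod (#) ` (Pow (src n (Suc m)) \<times> codes n m)"
  proof
    fix zs assume "zs \<in> codes n (Suc m)"
    then obtain p xs where "zs = p # xs" "xs \<in> codes n m" "p \<subseteq> src n (Suc m)" by auto
    then show "zs \<in> case_prod (#) ` (Pow (src n (Suc m)) \<times> codes n m)"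
      by (intro image_eqI[of _ _ "(p, xs)"]) auto
  qed
  then show ?case by (rule finite_subset) (use Suc in simp)
qed simp

section \<open>Weighted sums over two-element sets of sources\<close>

lemma sum_pairs_insert:
  fixes f :: "'a set \<Rightarrow> 'b :: comm_monoid_add"
  assumes "finite A" "a \<notin> A"
  shows "sum f (pairs (insert a A)) = sum f (pairs A) + (\<Sum>x\<in>A. f {a, x})"
proof -
  have eq: "pairs (insert a A) = pairs A \<union> (\<lambda>x. {a, x}) ` A"
  proof (rule equalityI; rule subsetI)
    fix p assume p: "p \<in> pairs (insert a A)"
    show "p \<in> pairs A \<union> (\<lambda>x. {a, x}) ` A"
    proof (cases "a \<in> p")
      case True
      obtain u v where "p = {u, v}" "u \<noteq> v" using p by (auto simp: card_2_iff)
      then show ?thesis using True p by (auto simp: insert_commute)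
    qed (use p in auto)
  next
    fix p assume "p \<in> pairs A \<union> (\<lambda>x. {a, x}) ` A"
    then show "p \<in> pairs (insert a A)" using assms by (auto simp: card_insert_if)
  qed
  have "inj_on (\<lambda>x. {a, x}) A" by (auto simp: inj_on_def doubleton_eq_iff)
  moreover have "pairs A \<inter> (\<lambda>x. {a, x}) ` A = {}" using assms by auto
  moreover have "finite (pairs A)" using assms(1) by (auto intro: finite_subset[of _ "Pow A"])
  ultimately show ?thesis
    unfolding eq using assms(1) by (subst sum.union_disjoint) (auto simp: sum.reindex)
qed

lemma sum_pairs_containing:
  fixes f :: "'a set \<Rightarrow> 'b :: comm_monoid_add"
  assumes "finite A" "a \<in> A"
  shows "(\<Sum>p\<in>{p \<in> pairs A. a \<in> p}. f p) = (\<Sum>x\<in>A - {a}. f {a, x})"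
proof -
  have fin: "finite (pairs A)" using assms(1) by (auto intro: finite_subset[of _ "Pow A"])
  have "(\<Sum>p\<in>{p \<in> pairs A. a \<in> p}. f p) = (\<Sum>p\<in>pairs A. if a \<in> p then f p else 0)"
    by (rule sum.inter_filter[OF fin])
  also have "(\<Sum>p\<in>pairs A. if a \<in> p then f p else 0)
      = (\<Sum>p\<in>pairs (insert a (A - {a})). if a \<in> p then f p else 0)"
    using assms(2) by (simp add: insert_absorb)
  also have "\<dots> = (\<Sum>x\<in>A - {a}. f {a, x})"
  proof (subst sum_pairs_insert)
    show "(\<Sum>p\<in>pairs (A - {a}). if a \<in> p then f p else 0) + (\<Sum>x\<in>A - {a}. if a \<in> {a, x} then f {a, x} else 0)
        = (\<Sum>x\<in>A - {a}. f {a, x})"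
      by (subst sum.neutral) auto
  qed (use assms(1) in auto)
  finally show ?thesis .
qed

context
  fixes A :: "nat set" and b r :: nat and y :: rat and j :: nat
  assumes A: "finite A" "b \<in> A" "r \<in> A" "b \<noteq> r" "card A = 2 * j + 4"
begin

text \<open>In the application \<open>A\<close> is \<open>src n (Suc m)\<close>, \<open>b\<close> is
  \<open>n\<close>, \<open>r\<close> is \<open>2 * n\<close> and \<open>j\<close> is
  \<open>n - m - 2\<close>. Only the shares of b and r are counted here; the share of g and the
  factor 2 come in later.\<close>

definition base_wt :: "nat set \<Rightarrow> rat" where
  "base_wt p = y ^ (of_bool (b \<in> p) + of_bool (r \<in> p))"

text \<open>Sort the pairs by how they meet \<open>{b, r}\<close>: \<open>(2j + 2) choose 2\<close>
  pairs avoid it, \<open>2 (2j + 2)\<close> pairs meet it once and weigh \<open>y\<close>, and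
  \<open>{b, r}\<close> itself weighs \<open>y\<^sup>2\<close>.\<close>

lemma sum_base_wt:
  "sum base_wt (pairs A) = of_nat ((j + 1) * (2 * j + 1)) + 4 * (of_nat j + 1) * y + y\<^sup>2"
proof -
  define A' where "A' = A - {b, r}"
  have A': "A = insert b (insert r A')" "b \<notin> insert r A'" "r \<notin> A'" "finite A'" "card A' = 2 * j + 2"
    using A by (auto simp: A'_def card_Diff_subset)
  have "sum base_wt (pairs A') = (\<Sum>p\<in>pairs A'. 1)"
    by (rule sum.cong) (use A' in \<open>auto simp: base_wt_def\<close>)
  also have "\<dots> = of_nat (card (pairs A'))" by simp
  also have "card (pairs A') = (2 * j + 2) choose 2" using n_subsets[OF A'(4), of 2] A'(5) by simp
  also have "\<dots> = (j + 1) * (2 * j + 1)" by (simp add: choose_two)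
  finally have 1: "sum base_wt (pairs A') = of_nat ((j + 1) * (2 * j + 1))" .
  have 2: "(\<Sum>x\<in>A'. base_wt {r, x}) = of_nat (2 * j + 2) * y"
  proof -
    have "(\<Sum>x\<in>A'. base_wt {r, x}) = (\<Sum>x\<in>A'. y)"
      by (rule sum.cong) (use A' A in \<open>auto simp: base_wt_def\<close>)
    then show ?thesis using A'(5) by simp
  qed
  have 3: "(\<Sum>x\<in>insert r A'. base_wt {b, x}) = y\<^sup>2 + of_nat (2 * j + 2) * y"
  proof -
    have "(\<Sum>x\<in>A'. base_wt {b, x}) = (\<Sum>x\<in>A'. y)"
      by (rule sum.cong) (use A' A in \<open>auto simp: base_wt_def\<close>)
    then show ?thesis using A' A by (simp add: base_wt_def power2_eq_square)
  qed
  show ?thesis unfolding A'(1) using A' 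
    by (subst sum_pairs_insert, simp, simp, subst sum_pairs_insert) (simp_all only: 1 2 3, simp_all add: algebra_simps)
qed

text \<open>The partner of \<open>a\<close> is \<open>b\<close> or \<open>r\<close>, with weight
  \<open>y\<close>, or one of the \<open>2j + 1\<close> other elements, with weight 1.\<close>

lemma sum_base_wt_containing:
  assumes "a \<in> A" "a \<noteq> b" "a \<noteq> r"
  shows "sum base_wt {p \<in> pairs A. a \<in> p} = 2 * y + 2 * of_nat j + 1"
proof -
  define A' where "A' = A - {a, b, r}"
  have A': "A - {a} = insert b (insert r A')" "b \<notin> insert r A'" "r \<notin> A'" "finite A'" "card A' = 2 * j + 1"
    using A assms by (auto simp: A'_def card_Diff_subset)
  have "(\<Sum>x\<in>A'. base_wt {a, x}) = (\<Sum>x\<in>A'. 1)"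
    by (rule sum.cong) (use A' A assms in \<open>auto simp: base_wt_def\<close>)
  then have "(\<Sum>x\<in>A'. base_wt {a, x}) = of_nat (2 * j + 1)" using A'(5) by simp
  moreover have "sum base_wt {p \<in> pairs A. a \<in> p} = (\<Sum>x\<in>A - {a}. base_wt {a, x})"
    by (rule sum_pairs_containing) (use A assms in auto)
  ultimately show ?thesis unfolding A'(1) using A' assms A
    by (simp add: base_wt_def)
qed

text \<open>This is the effect of adding column \<open>c = m + 1\<close>, with
  \<open>d = 2n - c\<close>: \<open>l\<close> and \<open>u\<close> tell whether \<open>c\<close> and
  \<open>d\<close> were picked before. An unpicked \<open>c\<close> forces the pair to contain
  \<open>c\<close>; an unpicked \<open>d\<close> doubles the pairs that miss
  \<open>d\<close>.\<close>

lemma sum_pair_weights: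
  assumes "c \<in> A" "d \<in> A" "c \<noteq> d" "c \<notin> {b, r}" "d \<notin> {b, r}"
  defines "V \<equiv> (y + of_nat j + 1) * (2 * y + 2 * of_nat j + 1)"
    and "K \<equiv> 2 * y + 2 * of_nat j + 1"
  shows "(\<Sum>p\<in>{p \<in> pairs A. c \<in> p \<or> l}. (if d \<in> p \<or> u then 1 else 2)
           * y ^ (of_bool (b \<in> p) + of_bool (r \<in> p) + of_bool (p = {b, c} \<and> l)))
         = (if l then if u then V else 2 * V - K else if u then K else 2 * K - 1)"
    (is "?S = _")
proof -
  have fin: "finite (pairs A)" using A by (auto intro: finite_subset[of _ "Pow A"])
  \<comment> \<open>Double all weights, then take back one copy of those of the pairs containing
    \<open>d\<close>.\<close>
  have split2: "(\<Sum>p\<in>P. (if d \<in> p \<or> u then 1 else 2) * w p) =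
      (if u then sum w P else 2 * sum w P - sum w {p \<in> P. d \<in> p})" if "finite P" for P and w :: "nat set \<Rightarrow> rat"
  proof (cases u)
    case False
    have "(\<Sum>p\<in>P. (if d \<in> p \<or> u then 1 else 2) * w p) = (\<Sum>p\<in>P. 2 * w p - (if d \<in> p then w p else 0))"
      using False by (intro sum.cong) auto
    then show ?thesis using False that by (simp add: sum_subtractf sum_distrib_left sum.inter_filter)
  qed simp
  show ?thesis
  proof (cases l)
    case True
    have bc: "{b, c} \<in> pairs A" using A assms by auto
    \<comment> \<open>The pair \<open>{b, c}\<close> has base weight \<open>y\<close>, so its extra
      factor \<open>y\<close> amounts to a surplus of \<open>y\<^sup>2 - y\<close>. With this
      surplus the sum of \<open>base_wt\<close> over all pairs factors as \<open>V\<close>.\<close>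
    have w: "y ^ (of_bool (b \<in> p) + of_bool (r \<in> p) + of_bool (p = {b, c} \<and> l))
        = base_wt p + (if p = {b, c} then y\<^sup>2 - y else 0)" for p
      using True assms A by (auto simp: base_wt_def power2_eq_square)
    have z: "(\<Sum>p\<in>{p \<in> pairs A. d \<in> p}. if p = {b, c} then y\<^sup>2 - y else 0) = 0"
      by (rule sum.neutral) (use assms in auto)
    have "?S = (if u then sum base_wt (pairs A) + (y\<^sup>2 - y)
         else 2 * (sum base_wt (pairs A) + (y\<^sup>2 - y)) - sum base_wt {p \<in> pairs A. d \<in> p})"
      using True assms fin bc unfolding w
      by (subst split2) (auto simp: sum.distrib sum.delta z[simplified])
    also have "sum base_wt {p \<in> pairs A. d \<in> p} = K"
      unfolding K_def by (rule sum_base_wt_containing) (use assms in auto)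
    finally show ?thesis using True
      by (simp add: sum_base_wt V_def K_def power2_eq_square algebra_simps)
  next
    case False
    define C where "C = {p \<in> pairs A. c \<in> p}"
    have C: "sum base_wt C = K"
      unfolding K_def C_def by (rule sum_base_wt_containing) (use assms in auto)
    have "{p \<in> C. d \<in> p} = {{c, d}}"
      using assms A by (auto simp: card_2_iff C_def)
    then have CD: "sum base_wt {p \<in> C. d \<in> p} = 1"
      using assms A by (simp add: base_wt_def)
    have "?S = (\<Sum>p\<in>C. (if d \<in> p \<or> u then 1 else 2) * base_wt p)"
      using False by (simp add: base_wt_def C_def)
    also have "\<dots> = (if u then sum base_wt C else 2 * sum base_wt C - sum base_wt {p \<in> C. d \<in> p})"
      by (rule split2) (use fin in \<open>auto simp: C_def intro: finite_subset[of _ "pairs A"]\<close>)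
    finally show ?thesis unfolding C CD using False by simp
  qed
qed

end

text \<open>Being a code and the weight depend only on incidences with \<open>n\<close>,
  \<open>2n\<close> and the sources \<open>c\<close>, \<open>2n - c\<close> for
  \<open>c \<le> m\<close>, and on which sources a column may pick. A relabelling that is injective
  on the sources in use and respects these therefore changes nothing. The set \<open>D\<close>
  allows \<open>f\<close> to be injective only where it matters.\<close>

lemma codes_relabel:
  assumes "xs \<in> codes n' m" "\<Union> (set xs) \<subseteq> D" "inj_on f D" "m < n'" "m < n"
    and fx: "n' \<in> D" "f n' = n" "2 * n' \<in> D" "f (2 * n') = 2 * n"
      "\<And>c. 1 \<le> c \<Longrightarrow> c \<le> m \<Longrightarrow> c \<in> D \<and> f c = c \<and> 2 * n' - c \<in> D \<and> f (2 * n' - c) = 2 * n - c"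
    and src: "\<And>c. 1 \<le> c \<Longrightarrow> c \<le> m \<Longrightarrow> f ` (src n' c \<inter> D) \<subseteq> src n c"
  shows "map ((`) f) xs \<in> codes n m \<and> wt n y (map ((`) f) xs) = wt n' y xs"
  using assms
proof (induction m arbitrary: xs)
  case (Suc m)
  obtain p zs where xs: "xs = p # zs" and zs: "zs \<in> codes n' m"
    and p: "p \<subseteq> src n' (Suc m)" "card p = 2" "Suc m \<in> p \<union> \<Union> (set zs)"
    using Suc.prems(1) by (rule codes_SucE)
  define U where "U = \<Union> (set zs)"
  have D: "p \<subseteq> D" "U \<subseteq> D" using Suc.prems(2) xs by (auto simp: U_def)
  have IH: "map ((`) f) zs \<in> codes n m" "wt n y (map ((`) f) zs) = wt n' y zs"
  proof -
    have "\<Union> (set zs) \<subseteq> D" using D by (simp add: U_def)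
    then have "map ((`) f) zs \<in> codes n m \<and> wt n y (map ((`) f) zs) = wt n' y zs"
      by (rule Suc.IH[OF zs _ Suc.prems(3) _ _ Suc.prems(6-9)])
         (use Suc.prems(4,5) in \<open>simp_all add: Suc.prems(10,11)\<close>)
    then show "map ((`) f) zs \<in> codes n m" "wt n y (map ((`) f) zs) = wt n' y zs" by blast+
  qed
  have Uf: "\<Union> (set (map ((`) f) zs)) = f ` U" by (auto simp: U_def)
  have mem: "f x \<in> f ` X \<longleftrightarrow> x \<in> X" if "x \<in> D" "X \<subseteq> D" for x X
    using inj_on_image_mem_iff[OF Suc.prems(3)] that by blast
  have fc: "Suc m \<in> D" "f (Suc m) = Suc m" "2 * n' - Suc m \<in> D" "f (2 * n' - Suc m) = 2 * n - Suc m"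
  proof -
    have "Suc m \<in> D \<and> f (Suc m) = Suc m \<and> 2 * n' - Suc m \<in> D \<and> f (2 * n' - Suc m) = 2 * n - Suc m"
      by (rule Suc.prems(10)) simp_all
    then show "Suc m \<in> D" "f (Suc m) = Suc m" "2 * n' - Suc m \<in> D" "f (2 * n' - Suc m) = 2 * n - Suc m"
      by blast+
  qed
  have "f ` p \<subseteq> src n (Suc m)" 
  proof -
    have "f ` (src n' (Suc m) \<inter> D) \<subseteq> src n (Suc m)" by (rule Suc.prems(11)) simp_all
    moreover have "p \<subseteq> src n' (Suc m) \<inter> D" using p D by simp
    ultimately show ?thesis by (meson image_mono order_trans)
  qed
  moreover have "card (f ` p) = 2" using p card_image[OF inj_on_subset[OF Suc.prems(3) D(1)]] by simp
  moreover have "Suc m \<in> f ` p \<union> f ` U" using mem[of "Suc m" "p \<union> U"] p fc D by (simp add: image_Un U_def)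
  ultimately have 1: "map ((`) f) xs \<in> codes n (Suc m)"
    unfolding xs list.map Cons_in_codes Uf using IH(1) by blast
  have len: "length zs = m" using length_codes[OF zs] .
  have a: "2 * n - Suc m \<in> f ` p \<union> f ` U \<longleftrightarrow> 2 * n' - Suc m \<in> p \<union> U"
    using mem[of "2 * n' - Suc m" "p \<union> U"] fc D by (simp add: image_Un)
  have b: "n \<in> f ` p \<longleftrightarrow> n' \<in> p" "2 * n \<in> f ` p \<longleftrightarrow> 2 * n' \<in> p"
    using mem[OF Suc.prems(6) D(1)] mem[OF Suc.prems(8) D(1)] by (simp_all add: Suc.prems(7,9))
  have "f ` p = {n, Suc m} \<longleftrightarrow> f ` p = f ` {n', Suc m}" using fc Suc.prems(7) by simp
  also have "\<dots> \<longleftrightarrow> p = {n', Suc m}"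
    using inj_on_image_eq_iff[OF Suc.prems(3), of p "{n', Suc m}"] D fc Suc.prems(6) by simp
  finally have c: "f ` p = {n, Suc m} \<longleftrightarrow> p = {n', Suc m}" .
  have d: "Suc m \<in> f ` U \<longleftrightarrow> Suc m \<in> U" using mem[of "Suc m" U] fc D by simp
  have "wt n y (map ((`) f) xs) = wt n' y xs"
    unfolding xs list.map wt.simps length_map len Uf U_def[symmetric] IH a col_stat_def b c d ..
  with 1 show ?case by (rule conjI)
qed simp

text \<open>Deleting the two unused sources \<open>m + 1\<close> and \<open>2n - m - 1\<close> yields a code for \<open>n - 1\<close>.\<close>

lemma code_sum_unused:
  assumes "m + 2 \<le> n"
  shows "(\<Sum>xs\<in>{xs \<in> codes n m. Suc m \<notin> \<Union> (set xs) \<and> 2 * n - Suc m \<notin> \<Union> (set xs)}. wt n y xs)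
    = code_sum (n - 1) m y"
proof -
  \<comment> \<open>\<open>up\<close> skips the two values \<open>m + 1\<close> and
    \<open>2n - m - 1\<close>, and \<open>dn\<close> closes these gaps. The middle
    \<open>n - 1\<close> moves by one to \<open>n\<close>, and \<open>2 (n - 1) - c\<close> with
    \<open>c \<le> m\<close> moves by two to \<open>2n - c\<close>.\<close>
  define up where "up x = (if x \<le> m then x else if x \<le> 2 * n - m - 3 then x + 1 else x + 2)" for x :: nat
  define dn where "dn x = (if x \<le> m then x else if x \<le> 2 * n - m - 2 then x - 1 else x - 2)" for x :: nat
  define D where "D = src n 1 - {Suc m, 2 * n - Suc m}"
  have dn_up: "dn (up x) = x" for x using assms by (auto simp: up_def dn_def)
  have up_dn: "up (dn x) = x" if "x \<in> D" for x using assms that by (auto simp: up_def dn_def D_def src_def)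
  have up_D: "up x \<in> D" if "x \<in> src (n - 1) 1" for x
    using assms that by (auto simp: up_def D_def src_def)
  have inj: "inj_on dn D" using up_dn by (metis inj_on_def)
  have inj': "inj_on up (src (n - 1) 1)" using dn_up by (metis inj_on_def)
  have 1: "map ((`) dn) xs \<in> codes (n - 1) m \<and> wt (n - 1) y (map ((`) dn) xs) = wt n y xs"
    if "xs \<in> codes n m" "\<Union> (set xs) \<subseteq> D" for xs
  proof (rule codes_relabel[OF that inj])
    show "n \<in> D" "2 * n \<in> D" using assms by (auto simp: D_def src_def)
    show "dn n = n - 1" "dn (2 * n) = 2 * (n - 1)" using assms by (auto simp: dn_def)
    show "c \<in> D \<and> dn c = c \<and> 2 * n - c \<in> D \<and> dn (2 * n - c) = 2 * (n - 1) - c" if "1 \<le> c" "c \<le> m" for c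
    proof -
      have "c \<in> D" "2 * n - c \<in> D" using assms that by (auto simp: D_def src_def)
      moreover have "dn (2 * n - c) = 2 * (n - 1) - c" using assms that by (simp add: dn_def diff_mult_distrib2)
      ultimately show ?thesis using that by (simp add: dn_def)
    qed
    show "dn ` (src n c \<inter> D) \<subseteq> src (n - 1) c" if "1 \<le> c" "c \<le> m" for c
    proof (rule image_subsetI)
      fix x assume "x \<in> src n c \<inter> D"
      then consider "x = 2 * n" | "c \<le> x" "x \<le> m" | "Suc m < x" "x \<le> 2 * n - m - 2"
        | "2 * n - m - 1 < x" "x \<le> 2 * n - c"
        unfolding src_def D_def by fastforce
      then show "dn x \<in> src (n - 1) c"
        by cases (use assms that in \<open>auto simp: dn_def src_def\<close>)
    qed
  qed (use assms in auto)
  have 2: "map ((`) up) xs \<in> codes n m" if "xs \<in> codes (n - 1) m" for xs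
  proof (rule codes_relabel[OF that codes_subset[OF that] inj', THEN conjunct1])
    show "n - 1 \<in> src (n - 1) 1" "2 * (n - 1) \<in> src (n - 1) 1" using assms by (auto simp: src_def)
    show "up (n - 1) = n" "up (2 * (n - 1)) = 2 * n" using assms by (auto simp: up_def)
    show "c \<in> src (n - 1) 1 \<and> up c = c \<and> 2 * (n - 1) - c \<in> src (n - 1) 1 \<and> up (2 * (n - 1) - c) = 2 * n - c"
      if "1 \<le> c" "c \<le> m" for c
    proof -
      have "c \<in> src (n - 1) 1" "2 * (n - 1) - c \<in> src (n - 1) 1" using assms that by (auto simp: src_def)
      moreover have "up (2 * (n - 1) - c) = 2 * n - c"
      proof -
        have "\<not> 2 * (n - 1) - c \<le> m" "\<not> 2 * (n - 1) - c \<le> 2 * n - m - 3" "2 * (n - 1) - c + 2 = 2 * n - c"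
          using assms that by arith+
        then show ?thesis by (simp add: up_def)
      qed
      ultimately show ?thesis using that by (simp add: up_def)
    qed
    show "up ` (src (n - 1) c \<inter> src (n - 1) 1) \<subseteq> src n c" if "1 \<le> c" "c \<le> m" for c
    proof (rule image_subsetI)
      fix x assume "x \<in> src (n - 1) c \<inter> src (n - 1) 1"
      then consider "x = 2 * (n - 1)" | "c \<le> x" "x \<le> 2 * (n - 1) - c"
        by (auto simp: src_def)
      then show "up x \<in> src n c"
        by cases (use assms that in \<open>auto simp: up_def src_def\<close>)
    qed
  qed (use assms in auto)
  have sub: "\<Union> (set xs) \<subseteq> D"
    if "xs \<in> codes n m" "Suc m \<notin> \<Union> (set xs)" "2 * n - Suc m \<notin> \<Union> (set xs)" for xs
    using codes_subset[OF that(1)] that by (auto simp: D_def)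
  have notin: "Suc m \<noteq> up x" "2 * n - Suc m \<noteq> up x" for x using assms by (auto simp: up_def)
  have id1: "map ((`) up) (map ((`) dn) xs) = xs" if "\<Union> (set xs) \<subseteq> D" for xs
  proof -
    have "up ` dn ` p = p" if "p \<in> set xs" for p
    proof -
      have "up (dn x) = x" if "x \<in> p" for x
        using that \<open>p \<in> set xs\<close> \<open>\<Union> (set xs) \<subseteq> D\<close> by (intro up_dn) auto
      then show ?thesis by (simp add: image_image cong: image_cong)
    qed
    then show ?thesis by (simp add: map_idI)
  qed
  have id2: "map ((`) dn) (map ((`) up) xs) = xs" for xs
    using dn_up by (simp add: image_image map_idI)
  show ?thesis unfolding code_sum_def
  proof (rule sum.reindex_bij_witness[where i = "map ((`) up)" and j = "map ((`) dn)"])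
    fix xs assume xs: "xs \<in> {xs \<in> codes n m. Suc m \<notin> \<Union> (set xs) \<and> 2 * n - Suc m \<notin> \<Union> (set xs)}"
    then have xs': "xs \<in> codes n m" "\<Union> (set xs) \<subseteq> D" using sub by blast+
    show "map ((`) up) (map ((`) dn) xs) = xs" by (rule id1[OF xs'(2)])
    show "map ((`) dn) xs \<in> codes (n - 1) m" "wt (n - 1) y (map ((`) dn) xs) = wt n y xs"
      using 1[OF xs'] by blast+
  next
    fix xs assume xs: "xs \<in> codes (n - 1) m"
    show "map ((`) dn) (map ((`) up) xs) = xs" by (rule id2)
    have "z \<notin> \<Union> (set (map ((`) up) xs))" if "\<And>x. z \<noteq> up x" for z
      using that by auto
    then show "map ((`) up) xs \<in> {xs \<in> codes n m. Suc m \<notin> \<Union> (set xs) \<and> 2 * n - Suc m \<notin> \<Union> (set xs)}"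
      using 2[OF xs] notin by blast
  qed
qed

text \<open>Exchange the sources \<open>m + 1\<close> and \<open>2n - m - 1\<close> everywhere. Both
  may be picked by each of the first \<open>m\<close> columns and neither has a special role there,
  so \<open>codes_relabel\<close> applies to this involution.\<close>

lemma code_sum_swap:
  assumes "m + 2 \<le> n"
  shows "(\<Sum>xs\<in>{xs \<in> codes n m. Suc m \<notin> \<Union> (set xs) \<and> 2 * n - Suc m \<in> \<Union> (set xs)}. wt n y xs)
    = (\<Sum>xs\<in>{xs \<in> codes n m. Suc m \<in> \<Union> (set xs) \<and> 2 * n - Suc m \<notin> \<Union> (set xs)}. wt n y xs)"
proof -
  define f where "f = transpose (Suc m) (2 * n - Suc m)"
  have ff: "f (f x) = x" for x by (simp add: f_def)
  have inj: "inj_on f (src n 1)" using ff by (metis inj_on_def)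
  have 1: "map ((`) f) xs \<in> codes n m \<and> wt n y (map ((`) f) xs) = wt n y xs" if "xs \<in> codes n m" for xs
  proof (rule codes_relabel[OF that codes_subset[OF that] inj])
    show "n \<in> src n 1" "2 * n \<in> src n 1" "f n = n" "f (2 * n) = 2 * n"
      using assms by (auto simp: src_def f_def transpose_def)
    show "c \<in> src n 1 \<and> f c = c \<and> 2 * n - c \<in> src n 1 \<and> f (2 * n - c) = 2 * n - c"
      if "1 \<le> c" "c \<le> m" for c
    proof -
      have "c \<in> src n 1" "2 * n - c \<in> src n 1" using assms that by (auto simp: src_def)
      moreover have "c \<notin> {Suc m, 2 * n - Suc m}" "2 * n - c \<notin> {Suc m, 2 * n - Suc m}"
        using assms that by auto
      ultimately show ?thesis by (simp add: f_def transpose_def)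
    qed
    show "f ` (src n c \<inter> src n 1) \<subseteq> src n c" if "1 \<le> c" "c \<le> m" for c
    proof -
      have "{Suc m, 2 * n - Suc m} \<subseteq> src n c" using assms that by (auto simp: src_def)
      then show ?thesis by (auto simp: f_def transpose_def)
    qed
  qed (use assms in auto)
  have ff': "map ((`) f) (map ((`) f) xs) = xs" for xs
    using ff by (simp add: image_image map_idI)
  have f1: "f (Suc m) = 2 * n - Suc m" "f (2 * n - Suc m) = Suc m" by (auto simp: f_def)
  define used where "used x xs \<longleftrightarrow> x \<in> \<Union> (set xs)" for x :: nat and xs :: "nat set list"
  have mem: "used x (map ((`) f) xs) \<longleftrightarrow> used (f x) xs" for x xs
  proof -
    have "x \<in> f ` p \<longleftrightarrow> f x \<in> p" for p using ff by (metis imageE imageI)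
    then show ?thesis by (simp add: used_def)
  qed
  show ?thesis unfolding used_def[symmetric]
    by (rule sum.reindex_bij_witness[where i = "map ((`) f)" and j = "map ((`) f)"])
       (use 1 ff' f1 in \<open>auto simp: mem simp del: map_map\<close>)
qed

section \<open>The recurrence of code sums and its solution by polynomials\<close>

lemma card_src: "Suc m \<le> n \<Longrightarrow> card (src n (Suc m)) = 2 * (n - m)"
  unfolding src_def by (subst card_Un_disjoint) auto

lemma code_sum_rec:
  fixes y :: rat
  assumes "m + 2 \<le> n"
  defines "z \<equiv> y + of_nat (n - m - 2)"
  shows "code_sum n (Suc m) y = (z + 1) * (2 * z + 1) * code_sum n m y - z * (2 * z - 1) * code_sum (n - 1) m y"
proof -
  define j where "j = n - m - 2"
  define A where "A = src n (Suc m)"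
  have zj: "z = y + of_nat j" by (simp add: z_def j_def)
  define c d where "c = Suc m" and "d = 2 * n - Suc m"
  define V where "V = (y + of_nat j + 1) * (2 * y + 2 * of_nat j + 1)"
  define K where "K = 2 * y + 2 * of_nat j + 1"
  define l where "l xs \<longleftrightarrow> c \<in> \<Union> (set xs)" for xs :: "nat set list"
  define u where "u xs \<longleftrightarrow> d \<in> \<Union> (set xs)" for xs :: "nat set list"
  define S where "S P = (\<Sum>xs\<in>{xs \<in> codes n m. P xs}. wt n y xs)" for P
  have A: "finite A" "n \<in> A" "2 * n \<in> A" "n \<noteq> 2 * n" "card A = 2 * j + 4" "c \<in> A" "d \<in> A" "c \<noteq> d"
    "c \<notin> {n, 2 * n}" "d \<notin> {n, 2 * n}"
    using assms by (auto simp: A_def src_def c_def d_def j_def card_src[unfolded src_def])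
  have "codes n (Suc m) = (\<lambda>(xs, p). p # xs) ` (SIGMA xs:codes n m. {p \<in> pairs A. c \<in> p \<or> l xs})"
    by (auto simp: A_def l_def c_def image_iff)
  then have "code_sum n (Suc m) y
      = (\<Sum>(xs, p)\<in>(SIGMA xs:codes n m. {p \<in> pairs A. c \<in> p \<or> l xs}). wt n y (p # xs))"
    unfolding code_sum_def by (simp add: sum.reindex inj_on_def split_beta prod_eq_iff)
  also have "\<dots> = (\<Sum>xs\<in>codes n m. \<Sum>p\<in>{p \<in> pairs A. c \<in> p \<or> l xs}. wt n y (p # xs))"
    using A(1) by (subst sum.Sigma) (auto intro: finite_subset[of _ "Pow A"])
  also have "\<dots> = (\<Sum>xs\<in>codes n m. wt n y xs *
      (if l xs then if u xs then V else 2 * V - K else if u xs then K else 2 * K - 1))"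
  proof (rule sum.cong[OF refl])
    fix xs assume "xs \<in> codes n m"
    then have len: "length xs = m" by (rule length_codes)
    have "(\<Sum>p\<in>{p \<in> pairs A. c \<in> p \<or> l xs}. wt n y (p # xs)) = wt n y xs *
       (\<Sum>p\<in>{p \<in> pairs A. c \<in> p \<or> l xs}. (if d \<in> p \<or> u xs then 1 else 2)
           * y ^ (of_bool (n \<in> p) + of_bool (2 * n \<in> p) + of_bool (p = {n, c} \<and> l xs)))"
      unfolding sum_distrib_left
      by (rule sum.cong) (auto simp: col_stat_def len l_def u_def c_def d_def)
    also have "(\<Sum>p\<in>{p \<in> pairs A. c \<in> p \<or> l xs}. (if d \<in> p \<or> u xs then 1 else 2)
           * y ^ (of_bool (n \<in> p) + of_bool (2 * n \<in> p) + of_bool (p = {n, c} \<and> l xs)))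
        = (if l xs then if u xs then V else 2 * V - K else if u xs then K else 2 * K - 1)"
      unfolding V_def K_def by (rule sum_pair_weights[OF A])
    finally show "(\<Sum>p\<in>{p \<in> pairs A. c \<in> p \<or> l xs}. wt n y (p # xs)) = wt n y xs *
      (if l xs then if u xs then V else 2 * V - K else if u xs then K else 2 * K - 1)" .
  qed
  \<comment> \<open>The four-case coefficient is written as the constant \<open>V\<close> plus
    corrections. Those for exactly one of \<open>c\<close>, \<open>d\<close> being picked have
    opposite signs and cancel by \<open>code_sum_swap\<close>; the one for neither leaves a code sum
    for \<open>n - 1\<close>.\<close>
  also have "\<dots> = (\<Sum>xs\<in>codes n m. V * wt n y xs + (2 * K - 1 - V) * (if \<not> l xs \<and> \<not> u xs then wt n y xs else 0)
      + (V - K) * (if l xs \<and> \<not> u xs then wt n y xs else 0) - (V - K) * (if \<not> l xs \<and> u xs then wt n y xs else 0))"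
    by (rule sum.cong) (auto simp: algebra_simps)
  also have "\<dots> = V * code_sum n m y + (2 * K - 1 - V) * S (\<lambda>xs. \<not> l xs \<and> \<not> u xs)
      + (V - K) * S (\<lambda>xs. l xs \<and> \<not> u xs) - (V - K) * S (\<lambda>xs. \<not> l xs \<and> u xs)"
    unfolding code_sum_def S_def by (simp only: sum.distrib sum_subtractf sum_distrib_left sum.inter_filter finite_codes)
  also have "S (\<lambda>xs. \<not> l xs \<and> u xs) = S (\<lambda>xs. l xs \<and> \<not> u xs)"
    using code_sum_swap[OF assms(1)] by (simp add: S_def l_def u_def c_def d_def)
  also have "S (\<lambda>xs. \<not> l xs \<and> \<not> u xs) = code_sum (n - 1) m y"
    using code_sum_unused[OF assms(1)] by (simp add: S_def l_def u_def c_def d_def)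
  \<comment> \<open>In terms of \<open>z = y + j\<close> one has \<open>V = (z + 1) (2z + 1)\<close>
    and \<open>2K - 1 - V = - z (2z - 1)\<close>.\<close>
  finally show ?thesis
    by (simp add: V_def K_def zj algebra_simps)
qed

text \<open>At \<open>x = 2z\<close> the factor 1/2 cancels in both coefficients, and the shift of
  \<open>x\<close> by 2 becomes a shift of \<open>z\<close> by 1.\<close>

lemma poly_P_poly_rec:
  "poly (P_poly (Suc (Suc m))) (2 * z) =
     (z + 1) * (2 * z + 1) * poly (P_poly (Suc m)) (2 * (z + 1)) - z * (2 * z - 1) * poly (P_poly (Suc m)) (2 * z)"
  by (simp add: poly_pcompose algebra_simps)

text \<open>Lowering \<open>n\<close> by one lowers the argument by 2, so the two code sums in
  \<open>code_sum_rec\<close> are values of one polynomial at \<open>2 (z + 1)\<close> and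
  \<open>2 z\<close>. At \<open>m = n - 1\<close> the argument is \<open>2 y\<close>.\<close>

lemma code_sum_eq_poly:
  assumes "m < n"
  shows "code_sum n m y = poly (P_poly (Suc m)) (2 * (y + of_nat (n - m - 1)))"
  using assms
proof (induction m arbitrary: n)
  case 0
  then show ?case by (simp add: code_sum_def)
next
  case (Suc m)
  define z where "z = y + of_nat (n - m - 2)"
  have "n - m - 1 = Suc (n - m - 2)" using Suc.prems by simp
  then have "y + of_nat (n - m - 1) = z + 1" by (simp add: z_def)
  moreover have "code_sum n m y = poly (P_poly (Suc m)) (2 * (y + of_nat (n - m - 1)))"
    by (rule Suc.IH) (use Suc.prems in simp)
  ultimately have "code_sum n m y = poly (P_poly (Suc m)) (2 * (z + 1))"
    by (simp only:)
  moreover have "code_sum (n - 1) m y = poly (P_poly (Suc m)) (2 * z)"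
  proof -
    have "n - 1 - m - 1 = n - m - 2" by simp
    then show ?thesis using Suc.IH[of "n - 1"] Suc.prems by (simp only: z_def)
  qed
  moreover have "code_sum n (Suc m) y
      = (z + 1) * (2 * z + 1) * code_sum n m y - z * (2 * z - 1) * code_sum (n - 1) m y"
    unfolding z_def by (rule code_sum_rec) (use Suc.prems in simp)
  moreover have "y + of_nat (n - Suc m - 1) = z" by (simp add: z_def numeral_2_eq_2)
  ultimately show ?case
    using poly_P_poly_rec[of m z] by (simp only:)
qed

subsection \<open>Placements and codes\<close>

text \<open>The condition that row \<open>c\<close> is used by a column up to \<open>c\<close>
  encodes \<open>i \<ge> j\<close>: no later column can then use row \<open>c\<close>. It mirrors
  the condition in \<open>codes\<close>, but here rows are used at most once, whereas sources may be
  picked repeatedly.\<close>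

primrec row_codes :: "nat \<Rightarrow> nat \<Rightarrow> nat set list set" where
  "row_codes n 0 = {[]}"
| "row_codes n (Suc m) = {q # zs | q zs. zs \<in> row_codes n m \<and> q \<subseteq> {1..2 * n} - \<Union> (set zs)
     \<and> card q = 2 \<and> Suc m \<in> q \<union> \<Union> (set zs)}"

text \<open>
  Contracting column \<open>c\<close> reroutes source \<open>c\<close> to the source of the lower row \<open>Min q\<close> and source
  \<open>2n - c\<close> to that of the upper row \<open>Max q\<close>. The transpositions do this even if one of these
  rows itself has source \<open>c\<close> or \<open>2n - c\<close>.
\<close>

primrec source :: "nat \<Rightarrow> nat set list \<Rightarrow> nat \<Rightarrow> nat" where
  "source n [] = id"
| "source n (q # zs) =
    (let c = Suc (length zs); r = transpose c (source n zs (Min q)) \<circ> source n zs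
     in transpose (2 * n - c) (r (Max q)) \<circ> r)"

primrec encode :: "nat \<Rightarrow> nat set list \<Rightarrow> nat set list" where
  "encode n [] = []"
| "encode n (q # zs) = (source n zs ` q) # encode n zs"

lemma Cons_in_row_codes: "q # zs \<in> row_codes n (Suc m) \<longleftrightarrow>
    zs \<in> row_codes n m \<and> q \<subseteq> {1..2 * n} - \<Union> (set zs) \<and> card q = 2 \<and> Suc m \<in> q \<union> \<Union> (set zs)"
  by simp

lemma row_codes_SucE:
  assumes "ws \<in> row_codes n (Suc m)"
  obtains q zs where "ws = q # zs" "zs \<in> row_codes n m" "q \<subseteq> {1..2 * n} - \<Union> (set zs)" "card q = 2"
    "Suc m \<in> q \<union> \<Union> (set zs)"
  using assms by auto

lemma length_row_codes: "zs \<in> row_codes n m \<Longrightarrow> length zs = m"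
proof (induction m arbitrary: zs)
  case (Suc m)
  from Suc.prems show ?case by (rule row_codes_SucE) (simp add: Suc.IH)
qed simp

lemma row_codes_used: "zs \<in> row_codes n m \<Longrightarrow> {1..m} \<subseteq> \<Union> (set zs)"
proof (induction m arbitrary: zs)
  case (Suc m)
  obtain q ys where "zs = q # ys" "ys \<in> row_codes n m" "Suc m \<in> q \<union> \<Union> (set ys)"
    using Suc.prems by (rule row_codes_SucE)
  then show ?case using Suc.IH[of ys] by (auto simp: atLeastAtMostSuc_conv)
qed simp

lemma src_one: "n \<ge> 1 \<Longrightarrow> src n 1 = {1..2 * n}"
  by (auto simp: src_def)

lemma src_Suc: "1 \<le> c \<Longrightarrow> c < n \<Longrightarrow> src n (Suc c) = src n c - {c, 2 * n - c}"
  by (auto simp: src_def)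

text \<open>After the two transpositions \<open>l\<close> goes to \<open>c\<close> and
  \<open>u\<close> goes to \<open>d\<close>, and the map is still a bijection onto \<open>S\<close>;
  deleting these two matched pairs leaves a bijection. The last two facts trace the rerouting one
  transposition at a time, for comparison with \<open>root_step\<close>.\<close>

lemma contract_bij:
  fixes r :: "'a \<Rightarrow> 'b"
  assumes bij: "bij_betw r A S" and "l \<in> A" "u \<in> A" "l \<noteq> u" "c \<in> S" "d \<in> S" "c \<noteq> d"
  defines "r1 \<equiv> transpose c (r l) \<circ> r"
  defines "r2 \<equiv> transpose d (r1 u) \<circ> r1"
  shows "bij_betw r2 (A - {l, u}) (S - {c, d})"
    and "\<And>x. x \<in> A \<Longrightarrow> x \<notin> {l, u} \<Longrightarrow> r x \<notin> {c, d} \<Longrightarrow> r2 x = r x"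
    and "\<And>x. x \<in> A \<Longrightarrow> x \<noteq> l \<Longrightarrow> r1 x = (if r x = c then r l else r x)"
    and "\<And>x. x \<in> A \<Longrightarrow> x \<noteq> l \<Longrightarrow> x \<noteq> u \<Longrightarrow> r2 x = (if r1 x = d then r1 u else r1 x)"
proof -
  have inj: "inj_on r A" and im: "r ` A = S" using bij by (auto simp: bij_betw_def)
  have S: "r l \<in> S" using assms im by auto
  have bij1: "bij_betw r1 A S"
    unfolding r1_def using assms S
    by (intro bij_betw_trans[OF bij]) (simp add: bij_betw_def transpose_image_eq)
  have inj1: "inj_on r1 A" using bij1 by (simp add: bij_betw_def)
  have S1: "r1 u \<in> S" using assms bij1 by (auto simp: bij_betw_def)
  have bij2: "bij_betw r2 A S"
    unfolding r2_def using assms S1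
    by (intro bij_betw_trans[OF bij1]) (simp add: bij_betw_def transpose_image_eq)
  have "r1 l = c" by (simp add: r1_def)
  moreover have "r1 u \<noteq> r1 l" using inj1 assms by (auto simp: inj_on_def)
  ultimately have "r2 l = c" using \<open>c \<noteq> d\<close> by (simp add: r2_def transpose_def)
  moreover have "r2 u = d" by (simp add: r2_def)
  ultimately have "r2 ` {l, u} = {c, d}" by simp
  moreover have "r2 ` (A - {l, u}) = r2 ` A - r2 ` {l, u}"
    using bij2 assms(2,3) by (intro inj_on_image_set_diff[of r2 A]) (auto simp: bij_betw_def)
  ultimately show "bij_betw r2 (A - {l, u}) (S - {c, d})"
    using bij2 by (simp only: bij_betw_def inj_on_diff)
  show r1: "r1 x = (if r x = c then r l else r x)" if "x \<in> A" "x \<noteq> l" for x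
  proof -
    have "r x \<noteq> r l" using that inj assms by (auto simp: inj_on_def)
    then show ?thesis by (simp add: r1_def transpose_def)
  qed
  show r2: "r2 x = (if r1 x = d then r1 u else r1 x)" if "x \<in> A" "x \<noteq> l" "x \<noteq> u" for x
  proof -
    have "r1 x \<noteq> r1 u" using that inj1 assms by (auto simp: inj_on_def)
    then show ?thesis by (simp add: r2_def transpose_def)
  qed
  show "r2 x = r x" if "x \<in> A" "x \<notin> {l, u}" "r x \<notin> {c, d}" for x
    using that r1[of x] r2[of x] by simp
qed

lemma Min_Max_pair:
  fixes q :: "nat set"
  assumes "card q = 2"
  shows "q = {Min q, Max q}" "Min q \<noteq> Max q"
proof -
  obtain a b where "q = {a, b}" "a \<noteq> b" using assms by (auto simp: card_2_iff)
  then show "q = {Min q, Max q}" "Min q \<noteq> Max q" by (auto simp: min_def max_def)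
qed

lemma source_bij:
  assumes "zs \<in> row_codes n m" "m < n"
  shows "bij_betw (source n zs) ({1..2 * n} - \<Union> (set zs)) (src n (Suc m))"
    and "\<And>x. x \<in> src n (Suc m) \<Longrightarrow> x \<notin> \<Union> (set zs) \<Longrightarrow> source n zs x = x"
  using assms
proof (induction m arbitrary: zs)
  case 0
  { case 1 then show ?case using src_one[of n] by (simp add: bij_betw_def) }
  { case 2 then show ?case by simp }
next
  case (Suc m)
  have *: "bij_betw (source n zs) ({1..2 * n} - \<Union> (set zs)) (src n (Suc (Suc m)))
    \<and> (\<forall>x. x \<in> src n (Suc (Suc m)) \<longrightarrow> x \<notin> \<Union> (set zs) \<longrightarrow> source n zs x = x)"
    if zs: "zs \<in> row_codes n (Suc m)" "Suc m < n" for zs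
  proof -
    obtain q ys where ws: "zs = q # ys" "ys \<in> row_codes n m" "q \<subseteq> {1..2 * n} - \<Union> (set ys)" "card q = 2"
      using zs(1) by (rule row_codes_SucE)
    define A where "A = {1..2 * n} - \<Union> (set ys)"
    define r where "r = source n ys"
    define l u where "l = Min q" and "u = Max q"
    define r2 where "r2 = source n zs"
    have q: "q = {l, u}" "l \<noteq> u" using Min_Max_pair[OF ws(4)] by (auto simp: l_def u_def)
    have lu: "l \<in> A" "u \<in> A" using ws(3) q by (auto simp: A_def)
    have cd: "Suc m \<in> src n (Suc m)" "2 * n - Suc m \<in> src n (Suc m)" "Suc m \<noteq> 2 * n - Suc m"
      using zs(2) by (auto simp: src_def)
    have bij: "bij_betw r A (src n (Suc m))"
      unfolding r_def A_def by (rule Suc.IH(1)) (use ws zs in auto)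
    have r2: "r2 = (let r1 = transpose (Suc m) (r l) \<circ> r in transpose (2 * n - Suc m) (r1 u) \<circ> r1)"
      by (simp add: r2_def ws(1) r_def l_def u_def length_row_codes[OF ws(2)] Let_def)
    note c = contract_bij[OF bij lu q(2) cd, folded r2[unfolded Let_def]]
    have A': "{1..2 * n} - \<Union> (set zs) = A - {l, u}" by (auto simp: A_def ws(1) q(1))
    have S': "src n (Suc (Suc m)) = src n (Suc m) - {Suc m, 2 * n - Suc m}"
      by (rule src_Suc) (use zs(2) in auto)
    have "r2 x = x" if x: "x \<in> src n (Suc (Suc m))" "x \<notin> \<Union> (set zs)" for x
    proof -
      have x': "x \<in> src n (Suc m)" "x \<notin> {Suc m, 2 * n - Suc m}" using x(1) S' by auto
      have "x \<notin> \<Union> (set ys)" "x \<notin> {l, u}" using x(2) ws(1) q(1) by auto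
      moreover have "x \<in> {1..2 * n}" using x'(1) src_antimono[of 1 "Suc m" n] src_one[of n] zs(2) by auto
      moreover have "r x = x" unfolding r_def
        by (rule Suc.IH(2)) (use ws zs x' \<open>x \<notin> \<Union> (set ys)\<close> in auto)
      ultimately show ?thesis using c(2)[of x] x'(2) by (simp add: A_def)
    qed
    then show ?thesis using c(1) unfolding A' S' r2_def[symmetric] by blast
  qed
  { case 1 then show ?case using * by blast }
  { case 2 then show ?case using * by blast }
qed

lemma encode_used:
  assumes "zs \<in> row_codes n m" "m < n" "q \<subseteq> {1..2 * n} - \<Union> (set zs)" "v \<in> src n (Suc m)"
    and "v \<in> \<Union> (set (encode n zs)) \<longleftrightarrow> v \<in> \<Union> (set zs)"
  shows "v \<in> source n zs ` q \<union> \<Union> (set (encode n zs)) \<longleftrightarrow> v \<in> q \<union> \<Union> (set zs)"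
proof (cases "v \<in> \<Union> (set zs)")
  case False
  let ?A = "{1..2 * n} - \<Union> (set zs)"
  have "inj_on (source n zs) ?A" using source_bij(1)[OF assms(1,2)] by (simp add: bij_betw_def)
  moreover have "v \<in> ?A" using False assms(2,4) src_antimono[of 1 "Suc m" n] src_one[of n] by auto
  moreover have "source n zs v = v" by (rule source_bij(2)[OF assms(1,2,4) False])
  ultimately have "v \<in> source n zs ` q \<longleftrightarrow> v \<in> q"
    using inj_on_image_mem_iff[of "source n zs" ?A v q] assms(3) by simp
  then show ?thesis using assms(5) by simp
qed (use assms(5) in simp)

lemma encode_bij:
  assumes "m < n"
  shows "bij_betw (encode n) (row_codes n m) (codes n m)"
    and "\<And>zs v. zs \<in> row_codes n m \<Longrightarrow> v \<in> src n (Suc m) \<Longrightarrow>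
      v \<in> \<Union> (set (encode n zs)) \<longleftrightarrow> v \<in> \<Union> (set zs)"
  using assms
proof (induction m)
  case 0
  { case 1 then show ?case by (simp add: bij_betw_def) }
  { case 2 then show ?case by simp }
next
  case (Suc m)
  have m: "m < n" if "Suc m < n" using that by simp
  have used: "v \<in> source n zs ` q \<union> \<Union> (set (encode n zs)) \<longleftrightarrow> v \<in> q \<union> \<Union> (set zs)"
    if "zs \<in> row_codes n m" "q \<subseteq> {1..2 * n} - \<Union> (set zs)" "v \<in> src n (Suc m)" "Suc m < n" for zs q v
    by (rule encode_used[OF that(1) m[OF that(4)] that(2,3)]) (rule Suc.IH(2)[OF that(1,3) m[OF that(4)]])
  {
    case 1
    note bij = Suc.IH(1)[OF m[OF 1]]
    note src = source_bij[OF _ m[OF 1]]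
    have c: "Suc m \<in> src n (Suc m)" using 1 by (simp add: src_def)
    show ?case
    proof (rule bij_betwI')
      fix ws ws' assume "ws \<in> row_codes n (Suc m)" "ws' \<in> row_codes n (Suc m)"
      then obtain q zs q' zs' where ws: "ws = q # zs" "zs \<in> row_codes n m" "q \<subseteq> {1..2 * n} - \<Union> (set zs)"
        and ws': "ws' = q' # zs'" "zs' \<in> row_codes n m" "q' \<subseteq> {1..2 * n} - \<Union> (set zs')"
        by (elim row_codes_SucE)
      have "q = q'" if "source n zs ` q = source n zs ` q'" "zs = zs'"
        using that ws ws' inj_on_image_eq_iff[of "source n zs" "{1..2 * n} - \<Union> (set zs)" q q']
          src(1)[OF ws(2)] by (simp add: bij_betw_def)
      moreover have "zs = zs'" if "encode n zs = encode n zs'"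
        using that bij ws(2) ws'(2) by (auto simp: bij_betw_def inj_on_def)
      ultimately show "encode n ws = encode n ws' \<longleftrightarrow> ws = ws'" using ws(1) ws'(1) by auto
    next
      fix ws assume "ws \<in> row_codes n (Suc m)"
      then obtain q zs where ws: "ws = q # zs" "zs \<in> row_codes n m" "q \<subseteq> {1..2 * n} - \<Union> (set zs)"
        "card q = 2" "Suc m \<in> q \<union> \<Union> (set zs)" by (rule row_codes_SucE)
      have "encode n zs \<in> codes n m" using bij ws(2) by (auto simp: bij_betw_def)
      moreover have "source n zs ` q \<subseteq> src n (Suc m)" 
        using image_mono[OF ws(3), of "source n zs"] src(1)[OF ws(2)] by (simp add: bij_betw_def)
      moreover have "card (source n zs ` q) = 2"
        using src(1)[OF ws(2)] ws(3,4) by (metis bij_betw_def card_image inj_on_subset)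
      moreover have "Suc m \<in> source n zs ` q \<union> \<Union> (set (encode n zs))"
        using used[OF ws(2,3) c 1] ws(5) by simp
      ultimately show "encode n ws \<in> codes n (Suc m)"
        unfolding ws(1) encode.simps Cons_in_codes by blast
    next
      fix xs assume "xs \<in> codes n (Suc m)"
      then obtain p ys where xs: "xs = p # ys" "ys \<in> codes n m" "p \<subseteq> src n (Suc m)" "card p = 2"
        "Suc m \<in> p \<union> \<Union> (set ys)" by (rule codes_SucE)
      obtain zs where zs: "zs \<in> row_codes n m" "ys = encode n zs"
        using bij xs(2) by (auto simp: bij_betw_def)
      obtain q where q: "q \<subseteq> {1..2 * n} - \<Union> (set zs)" "p = source n zs ` q"
      proof -
        have "p \<subseteq> source n zs ` ({1..2 * n} - \<Union> (set zs))"
          using src(1)[OF zs(1)] xs(3) by (simp add: bij_betw_def)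
        then show ?thesis using that by (rule subset_imageE)
      qed
      have "card q = 2"
        using src(1)[OF zs(1)] q xs(4) by (metis bij_betw_def card_image inj_on_subset)
      moreover have "Suc m \<in> q \<union> \<Union> (set zs)"
        using used[OF zs(1) q(1) c 1] xs(5) zs(2) q(2) by simp
      ultimately have "q # zs \<in> row_codes n (Suc m)"
        unfolding Cons_in_row_codes using zs(1) q(1) by blast
      moreover have "encode n (q # zs) = xs" by (simp add: xs(1) zs(2) q(2))
      ultimately show "\<exists>ws\<in>row_codes n (Suc m). xs = encode n ws" by metis
    qed
  next
    case 2
    obtain q ys where ws: "zs = q # ys" "ys \<in> row_codes n m" "q \<subseteq> {1..2 * n} - \<Union> (set ys)"
      using 2(1) by (rule row_codes_SucE)
    have "v \<in> src n (Suc m)" using 2(2) src_antimono[of "Suc m" "Suc (Suc m)" n] by auto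
    from used[OF ws(2,3) this 2(3)] show ?case by (simp add: ws(1))
  }
qed

section \<open>Placements as lists of columns\<close>

definition col :: "point set \<Rightarrow> nat \<Rightarrow> nat set" where
  "col T c = {i. (c, i) \<in> T}"

primrec cols :: "point set \<Rightarrow> nat \<Rightarrow> nat set list" where
  "cols T 0 = []"
| "cols T (Suc m) = col T (Suc m) # cols T m"

lemma Union_cols: "\<Union> (set (cols T m)) = {i. \<exists>c\<in>{1..m}. (c, i) \<in> T}"
  by (induction m) (auto simp: col_def atLeastAtMostSuc_conv)

lemma cols_cong: "(\<And>c. 1 \<le> c \<Longrightarrow> c \<le> m \<Longrightarrow> col T c = col T' c) \<Longrightarrow> cols T m = cols T' m"
  by (induction m) auto

lemma cols_eqD: "cols T m = cols T' m \<Longrightarrow> 1 \<le> c \<Longrightarrow> c \<le> m \<Longrightarrow> col T c = col T' c"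
  by (induction m) (auto simp: le_Suc_eq)

lemma length_cols [simp]: "length (cols T m) = m"
  by (induction m) auto

lemma card_col: "card {p \<in> T. fst p = c} = card (col T c)"
proof -
  have "{p \<in> T. fst p = c} = Pair c ` col T c" by (auto simp: col_def)
  then show ?thesis by (simp add: card_image inj_on_def)
qed

locale placement =
  fixes n :: nat and T :: "point set"
  assumes n: "n \<ge> 1" and T: "T \<in> placements n"
begin

lemma in_grid: "(c, i) \<in> T \<Longrightarrow> c \<in> {1..n} \<and> i \<in> {1..2 * n} \<and> c \<le> i"
  using T by (auto simp: placements_def)

lemma row_ex:
  assumes "i \<in> {1..2 * n}" shows "\<exists>c. (c, i) \<in> T"
proof -
  have "\<exists>!p. p \<in> T \<and> snd p = i" using T assms by (simp add: placements_def)
  then show ?thesis by (metis prod.collapse)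
qed

lemma row_unique:
  assumes "(c, i) \<in> T" "(c', i) \<in> T" shows "c = c'"
proof -
  have "\<exists>!p. p \<in> T \<and> snd p = i" using T in_grid[OF assms(1)] by (simp add: placements_def)
  then show ?thesis using assms by auto
qed

lemma row_point_eq: "(c, i) \<in> T \<Longrightarrow> row_point T i = (c, i)"
  unfolding row_point_def by (rule the_equality) (auto dest: row_unique)

lemma col_card: "c \<in> {1..n} \<Longrightarrow> card (col T c) = 2"
  using T by (auto simp: placements_def simp flip: card_col)

lemma col_subset: "c \<in> {1..n} \<Longrightarrow> col T c \<subseteq> {1..2 * n} - \<Union> (set (cols T (c - 1)))"
proof
  fix i assume c: "c \<in> {1..n}" and "i \<in> col T c"
  then have i: "(c, i) \<in> T" by (simp add: col_def)
  then have "(c', i) \<notin> T" if "c' \<le> c - 1" for c'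
    using row_unique[of c i c'] that c by auto
  then show "i \<in> {1..2 * n} - \<Union> (set (cols T (c - 1)))"
    using in_grid[OF i] by (auto simp: Union_cols)
qed

lemma cols_in_row_codes: "m \<le> n \<Longrightarrow> cols T m \<in> row_codes n m"
proof (induction m)
  case (Suc m)
  have "col T (Suc m) \<subseteq> {1..2 * n} - \<Union> (set (cols T m))" using col_subset[of "Suc m"] Suc.prems by simp
  moreover have "card (col T (Suc m)) = 2" using col_card Suc.prems by simp
  moreover have "Suc m \<in> col T (Suc m) \<union> \<Union> (set (cols T m))"
  proof -
    obtain c where "(c, Suc m) \<in> T" using row_ex[of "Suc m"] Suc.prems by auto
    then show ?thesis using in_grid[of c "Suc m"] by (auto simp: Union_cols col_def le_Suc_eq)
  qed
  ultimately show ?case unfolding cols.simps Cons_in_row_codes using Suc by simp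
qed simp

text \<open>Every row has to be used, so the last column takes whatever the others leave. This is
  why codes only record the first \<open>n - 1\<close> columns.\<close>

lemma last_col: "col T n = {1..2 * n} - \<Union> (set (cols T (n - 1)))"
proof
  show "{1..2 * n} - \<Union> (set (cols T (n - 1))) \<subseteq> col T n"
  proof
    fix i assume i: "i \<in> {1..2 * n} - \<Union> (set (cols T (n - 1)))"
    then obtain c where c: "(c, i) \<in> T" using row_ex by auto
    moreover have "c \<notin> {1..n - 1}" using i c by (auto simp: Union_cols)
    ultimately have "c = n" using in_grid[OF c] n by auto
    then show "i \<in> col T n" using c by (simp add: col_def)
  qed
qed (use col_subset[of n] n in simp)

end

lemma placement_from_row_code:
  assumes "ws \<in> row_codes n m" "m \<le> n"
  shows "\<exists>T. cols T m = ws \<and> T \<subseteq> {1..m} \<times> {1..2 * n} \<and> (\<forall>(c, i)\<in>T. c \<le> i)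
    \<and> (\<forall>c c' i. (c, i) \<in> T \<longrightarrow> (c', i) \<in> T \<longrightarrow> c = c') \<and> (\<forall>c\<in>{1..m}. card (col T c) = 2)"
  using assms
proof (induction m arbitrary: ws)
  case 0
  then show ?case by (intro exI[of _ "{}"]) simp
next
  case (Suc m)
  obtain q zs where ws: "ws = q # zs" "zs \<in> row_codes n m" "q \<subseteq> {1..2 * n} - \<Union> (set zs)" "card q = 2"
    using Suc.prems(1) by (rule row_codes_SucE)
  obtain T where T: "cols T m = zs" "T \<subseteq> {1..m} \<times> {1..2 * n}" "\<And>c i. (c, i) \<in> T \<Longrightarrow> c \<le> i"
    "\<And>c c' i. (c, i) \<in> T \<Longrightarrow> (c', i) \<in> T \<Longrightarrow> c = c'" "\<And>c. c \<in> {1..m} \<Longrightarrow> card (col T c) = 2"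
    using Suc.IH[OF ws(2)] Suc.prems(2) by fastforce
  define T' where "T' = T \<union> {Suc m} \<times> q"
  have new: "col T' (Suc m) = q" using T(2) by (auto simp: T'_def col_def)
  have old: "col T' c = col T c" if "c \<le> m" for c using that by (auto simp: T'_def col_def)
  have disj: "i \<notin> q" if "(c, i) \<in> T" for c i
  proof -
    have "i \<in> \<Union> (set (cols T m))" using that T(2) by (auto simp: Union_cols)
    then show ?thesis using ws(3) T(1) by auto
  qed
  \<comment> \<open>The rows up to \<open>m\<close> are exhausted by the first \<open>m\<close>
    columns.\<close>
  have "Suc m \<le> i" if "i \<in> q" for i
  proof (rule ccontr)
    assume "\<not> Suc m \<le> i"
    then have "i \<in> {1..m}" using that ws(3) by auto
    then have "i \<in> \<Union> (set zs)" using row_codes_used[OF ws(2)] by blast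
    then show False using that ws(3) by blast
  qed
  then have "\<forall>(c, i)\<in>T'. c \<le> i" using T(3) by (auto simp: T'_def)
  moreover have "cols T' (Suc m) = ws"
    using new old T(1) cols_cong[of m T' T] by (simp add: ws(1))
  moreover have "T' \<subseteq> {1..Suc m} \<times> {1..2 * n}" using T(2) ws(3) by (auto simp: T'_def)
  moreover have "\<forall>c c' i. (c, i) \<in> T' \<longrightarrow> (c', i) \<in> T' \<longrightarrow> c = c'"
    using T(4) disj by (auto simp: T'_def)
  moreover have "\<forall>c\<in>{1..Suc m}. card (col T' c) = 2"
    using T(5) old new ws(4) by (auto simp: le_Suc_eq)
  ultimately show ?case by blast
qed

lemma cols_bij:
  assumes n: "n \<ge> 1"
  shows "bij_betw (\<lambda>T. cols T (n - 1)) (placements n) (row_codes n (n - 1))"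
proof (rule bij_betwI')
  fix T T' assume "T \<in> placements n" "T' \<in> placements n"
  then interpret T: placement n T + T': placement n T' using n by (simp_all add: placement_def)
  show "cols T (n - 1) = cols T' (n - 1) \<longleftrightarrow> T = T'"
  proof
    assume eq: "cols T (n - 1) = cols T' (n - 1)"
    have "col T c = col T' c" if "c \<in> {1..n}" for c
    proof (cases "c = n")
      case True
      then show ?thesis using T.last_col T'.last_col eq by simp
    next
      case False
      then have "c \<le> n - 1" using that by auto
      then show ?thesis using cols_eqD[OF eq, of c] that by simp
    qed
    then have "(c, i) \<in> T \<longleftrightarrow> (c, i) \<in> T'" for c i
      using T.in_grid[of c i] T'.in_grid[of c i] by (auto simp: col_def)
    then show "T = T'" by auto
  qed simp
next
  fix T assume "T \<in> placements n"
  then interpret placement n T using n by (simp add: placement_def)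
  show "cols T (n - 1) \<in> row_codes n (n - 1)" by (rule cols_in_row_codes) simp
next
  fix zs assume zs: "zs \<in> row_codes n (n - 1)"
  \<comment> \<open>The only candidate for the last column. It has two rows because
    \<open>source\<close> matches it with \<open>src n n\<close>, that is, with \<open>n\<close> and
    \<open>2n\<close>.\<close>
  define q where "q = {1..2 * n} - \<Union> (set zs)"
  have nn: "Suc (n - 1) = n" using n by simp
  have "card q = card (src n n)"
    unfolding q_def using bij_betw_same_card[OF source_bij(1)[OF zs]] n by simp
  also have "\<dots> = 2" using card_src[of "n - 1" n] nn n by simp
  finally have "q # zs \<in> row_codes n (Suc (n - 1))"
    unfolding Cons_in_row_codes using zs n by (auto simp: q_def)
  from placement_from_row_code[OF this] obtain T where T: "cols T (Suc (n - 1)) = q # zs"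
    "T \<subseteq> {1..n} \<times> {1..2 * n}" "\<forall>(c, i)\<in>T. c \<le> i"
    "\<And>c c' i. (c, i) \<in> T \<Longrightarrow> (c', i) \<in> T \<Longrightarrow> c = c'" "\<forall>c\<in>{1..n}. card (col T c) = 2"
    unfolding nn by fastforce
  have "\<exists>!p. p \<in> T \<and> snd p = i" if "i \<in> {1..2 * n}" for i
  proof -
    have "i \<in> \<Union> (set (cols T n))" using that T(1) by (auto simp: nn q_def)
    then obtain c where "(c, i) \<in> T" by (auto simp: Union_cols)
    then show ?thesis using T(4) by (intro ex1I[of _ "(c, i)"]) auto
  qed
  then have "T \<in> placements n" using T(2,3,5) by (simp add: placements_def card_col)
  moreover have "cols T (n - 1) = zs" using T(1) by simp
  ultimately show "\<exists>T\<in>placements n. zs = cols T (n - 1)" by auto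
qed

subsection \<open>The statistics in terms of sources\<close>

text \<open>Successive records are found by taking the next larger value, and bounded columns make
  this end at the maximum. The set on the right describes the records without recursion, which is
  the form needed to relate them to roots.\<close>

lemma record_index_bij:
  fixes c :: "nat \<Rightarrow> point"
  assumes bound: "\<And>k. fst (c k) \<le> N"
  shows "bij_betw (record_index c) {..last_record c} {k. \<forall>k'<k. fst (c k') < fst (c k)}"
proof -
  define f where "f k = fst (c k)" for k
  define g where "g = record_index c"
  define R where "R = {k. \<forall>k'<k. f k' < f k}"
  define M where "M = Max (range f)"
  have fin: "finite (range f)" by (rule finite_subset[of _ "{..N}"]) (use bound in \<open>auto simp: f_def\<close>)
  have le_M: "f k \<le> M" for k using fin by (simp add: M_def)
  have "M \<in> range f" using fin by (simp add: M_def)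
  then obtain kM where kM: "f kM = M" by auto
  have g_Suc: "g (Suc q) = (LEAST k. k > g q \<and> f k > f (g q))" for q by (simp add: g_def f_def)
  have step: "g q < g (Suc q) \<and> f (g q) < f (g (Suc q)) \<and> g (Suc q) \<in> R
      \<and> (\<forall>k. g q < k \<longrightarrow> k < g (Suc q) \<longrightarrow> f k \<le> f (g q))"
    if "g q \<in> R" "f (g q) \<noteq> M" for q
  proof -
    have lt: "f (g q) < f kM" using that(2) le_M[of "g q"] kM by simp
    have "kM > g q"
    proof (rule ccontr)
      assume "\<not> kM > g q"
      then have "f kM \<le> f (g q)" using that(1) by (cases "kM = g q") (auto simp: R_def intro: less_imp_le)
      then show False using lt by simp
    qed
    then have ex: "g (Suc q) > g q \<and> f (g (Suc q)) > f (g q)"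
      unfolding g_Suc using lt by (metis (mono_tags, lifting) LeastI)
    have min: "f k \<le> f (g q)" if "g q < k" "k < g (Suc q)" for k
      using not_less_Least[of k "\<lambda>k. k > g q \<and> f k > f (g q)"] that unfolding g_Suc by simp
    have "f k < f (g (Suc q))" if "k < g (Suc q)" for k
    proof -
      consider "k < g q" | "k = g q" | "k > g q" by linarith
      then have "f k \<le> f (g q)"
      proof cases
        case 1
        then show ?thesis using \<open>g q \<in> R\<close> by (auto simp: R_def intro: less_imp_le)
      qed (use min that in auto)
      then show ?thesis using ex by simp
    qed
    then show ?thesis using ex min by (auto simp: R_def)
  qed
  have g0: "g 0 \<in> R" by (simp add: g_def R_def)
  \<comment> \<open>Each new record raises the value by at least one, so the maximum
    \<open>M\<close> is attained by record \<open>Suc M\<close> at the latest. Hence the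
    \<open>LEAST\<close> in \<open>last_record\<close> ranges over a nonempty set.\<close>
  have climb: "(\<exists>q'\<le>q. f (g q') = M) \<or> (g q \<in> R \<and> q \<le> f (g q))" for q
  proof (induction q)
    case 0
    then show ?case using g0 by simp
  next
    case (Suc q)
    show ?case
    proof (cases "\<exists>q'\<le>q. f (g q') = M")
      case True
      then obtain q' where q': "q' \<le> q" "f (g q') = M" by blast
      then have "q' \<le> Suc q" by simp
      then show ?thesis using q'(2) by blast
    next
      case False
      then have "g q \<in> R" "q \<le> f (g q)" "f (g q) \<noteq> M" using Suc.IH by blast+
      then show ?thesis using step[of q] by simp
    qed
  qed
  have ex_last: "\<exists>q. f (g q) = M"
    using climb[of "Suc M"] le_M[of "g (Suc M)"] by auto
  define L where "L = last_record c"
  have L_def': "L = (LEAST q. f (g q) = M)"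
    by (simp add: L_def last_record_def f_def g_def M_def)
  have L: "f (g L) = M" unfolding L_def' using ex_last by (rule LeastI_ex)
  have before: "f (g q) \<noteq> M" if "q < L" for q using that not_less_Least unfolding L_def' by blast
  have gR: "g q \<in> R" if "q \<le> L" for q
    using that
  proof (induction q)
    case (Suc q)
    then show ?case using step[of q] before[of q] by simp
  qed (rule g0)
  have mono: "g q < g q'" if "q < q'" "q' \<le> L" for q q'
    using that
  proof (induction q')
    case (Suc q')
    have "g q' < g (Suc q')" using step[of q'] before[of q'] gR[of q'] Suc.prems by simp
    then show ?case using Suc by (cases "q = q'") auto
  qed simp
  \<comment> \<open>Locate \<open>k\<close> between two consecutive enumerated indices, or after the
    last one. Strictly past the left end no value exceeds the value there, so a record
    \<open>k\<close> must be that left end.\<close>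
  have "k \<in> g ` {..L}" if k: "k \<in> R" for k
  proof -
    have "\<exists>q\<le>L. g q \<le> k \<and> (q = L \<or> k < g (Suc q))"
    proof (cases "g L \<le> k")
      case False
      have "k < g q \<Longrightarrow> q \<le> L \<Longrightarrow> \<exists>q\<le>L. g q \<le> k \<and> (q = L \<or> k < g (Suc q))" for q
      proof (induction q)
        case 0
        then show ?case by (simp add: g_def)
      next
        case (Suc q)
        show ?case
        proof (cases "k < g q")
          case False
          then show ?thesis using Suc.prems by (intro exI[of _ q]) simp
        qed (use Suc in simp)
      qed
      from this[of L] show ?thesis using False by simp
    next
      case True
      then show ?thesis by blast
    qed
    then obtain q where q: "q \<le> L" "g q \<le> k" "q = L \<or> k < g (Suc q)" by blast
    have "\<not> g q < k"
    proof
      assume less: "g q < k"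
      then have "f (g q) < f k" using k by (simp add: R_def)
      moreover have "f k \<le> f (g q)"
      proof (cases "q = L")
        case True
        then show ?thesis using L le_M by simp
      next
        case False
        then have "q < L" using q(1) by simp
        then show ?thesis using step[OF gR[OF q(1)] before] q(3) less False by blast
      qed
      ultimately show False by simp
    qed
    then show ?thesis using q(1,2) by auto
  qed
  then have "g ` {..L} = R" using gR by auto
  moreover have "inj_on g {..L}"
  proof (rule inj_onI)
    fix q q' assume "q \<in> {..L}" "q' \<in> {..L}" "g q = g q'"
    then show "q = q'" using mono[of q q'] mono[of q' q] by (cases q q' rule: linorder_cases) simp_all
  qed
  ultimately show ?thesis by (simp add: bij_betw_def R_def f_def L_def g_def)
qed

section \<open>Roots as sources\<close>

context placement
begin

abbreviation avail :: "nat \<Rightarrow> nat set" where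
  "avail c \<equiv> {1..2 * n} - \<Union> (set (cols T (c - 1)))"

definition col_source :: "nat \<Rightarrow> nat \<Rightarrow> nat" where
  "col_source c = source n (cols T (c - 1))"

lemma col_source_bij: "c \<in> {1..n} \<Longrightarrow> bij_betw (col_source c) (avail c) (src n c)"
  unfolding col_source_def using source_bij(1)[of "cols T (c - 1)" n "c - 1"] cols_in_row_codes[of "c - 1"] by auto

lemma col_source_fixed:
  "c \<in> {1..n} \<Longrightarrow> x \<in> src n c \<Longrightarrow> x \<in> avail c \<Longrightarrow> col_source c x = x"
  unfolding col_source_def using source_bij(2)[of "cols T (c - 1)" n "c - 1" x] cols_in_row_codes[of "c - 1"] by auto

lemma in_avail: "(c, i) \<in> T \<Longrightarrow> i \<in> avail c"
  using col_subset[of c] in_grid[of c i] by (auto simp: col_def)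

lemma col_source_inj:
  assumes "(c, i) \<in> T" "(c, i') \<in> T" "col_source c i = col_source c i'"
  shows "i = i'"
  using col_source_bij[of c] in_grid[OF assms(1)] in_avail[OF assms(1)] in_avail[OF assms(2)] assms(3)
  by (auto simp: bij_betw_def inj_on_def)

lemma upper_row_eq: "upper_row T c = Max (col T c)" and lower_row_eq: "lower_row T c = Min (col T c)"
  by (simp_all add: upper_row_def lower_row_def col_def)

lemma col_eq:
  assumes "c \<in> {1..n}" shows "col T c = {lower_row T c, upper_row T c}" "lower_row T c \<noteq> upper_row T c"
  using Min_Max_pair[OF col_card[OF assms]] by (simp_all add: upper_row_eq lower_row_eq)

lemma upper_in: "c \<in> {1..n} \<Longrightarrow> (c, upper_row T c) \<in> T"
  and lower_in: "c \<in> {1..n} \<Longrightarrow> (c, lower_row T c) \<in> T"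
  using col_eq[of c] by (auto simp: col_def)

lemma next_upper: "1 \<le> c \<Longrightarrow> c < n \<Longrightarrow> next_point n T (c, upper_row T c) = row_point T (2 * n - c)"
  and next_lower: "1 \<le> c \<Longrightarrow> c < n \<Longrightarrow> next_point n T (c, lower_row T c) = row_point T c"
  using col_eq(2)[of c] by (simp_all add: next_point_def)

lemma row_point_in: "i \<in> {1..2 * n} \<Longrightarrow> row_point T i \<in> T \<and> snd (row_point T i) = i"
  using row_ex[of i] row_point_eq by auto

lemma root_step_fixed: "v \<in> src n c \<Longrightarrow> root_step n T c v = v"
  by (auto simp: root_step_def src_def)

lemma root_steps_fixed: "v \<in> src n c \<Longrightarrow> (root_step n T c ^^ k) v = v"
  by (induction k) (simp_all add: root_step_fixed)

text \<open>A root step is a path step taken backwards: it leads from row \<open>x\<close> to the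
  row of a point in an earlier column whose path successor lies in row \<open>x\<close>.\<close>

lemma root_step_back:
  assumes "x \<in> {1..2 * n}" "x \<notin> src n c" "c \<in> {1..n}"
  obtains c' where "1 \<le> c'" "c' < c" "(c', root_step n T c x) \<in> T"
    "next_point n T (c', root_step n T c x) = row_point T x" "root_step n T c x \<in> {1..2 * n}"
proof (cases "x < c")
  case True
  then have "root_step n T c x = lower_row T x" using assms by (auto simp: root_step_def src_def)
  moreover have "(x, lower_row T x) \<in> T" using lower_in[of x] True assms by simp
  ultimately show ?thesis using that[of x] next_lower[of x] in_grid[of x "lower_row T x"] True assms by auto
next
  case False
  then have x: "2 * n - c < x" "x < 2 * n" using assms by (auto simp: src_def)
  then have "root_step n T c x = upper_row T (2 * n - x)" using assms by (auto simp: root_step_def src_def)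
  moreover have d: "2 * n - x \<in> {1..n}" "2 * n - x < c" using x assms(3) by auto
  moreover have "(2 * n - x, upper_row T (2 * n - x)) \<in> T" by (rule upper_in[OF d(1)])
  moreover have "2 * n - (2 * n - x) = x" using x by simp
  ultimately show ?thesis
    using that[of "2 * n - x"] next_upper[of "2 * n - x"] in_grid[of "2 * n - x" "upper_row T (2 * n - x)"] x assms
    by auto
qed

text \<open>Conversely, a path step leaving a column before \<open>c\<close> enters row
  \<open>2n - c'\<close> or \<open>c'\<close>, and there \<open>root_step\<close> recovers the upper
  or lower row just left.\<close>

lemma root_step_next:
  assumes "(c', r) \<in> T" "c' < c" "c \<le> n"
  shows "next_point n T (c', r) \<in> T" "root_step n T c (snd (next_point n T (c', r))) = r"
proof -
  have c': "c' \<in> {1..n}" "c' < n" using in_grid[OF assms(1)] assms by auto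
  consider "r = upper_row T c'" | "r = lower_row T c'" using col_eq(1)[OF c'(1)] assms(1) by (auto simp: col_def)
  then have "next_point n T (c', r) \<in> T \<and> root_step n T c (snd (next_point n T (c', r))) = r"
  proof cases
    case 1
    have "snd (row_point T (2 * n - c')) = 2 * n - c'" "row_point T (2 * n - c') \<in> T"
      using row_point_in[of "2 * n - c'"] c' by auto
    moreover have "root_step n T c (2 * n - c') = upper_row T (2 * n - (2 * n - c'))"
      using c' assms(2,3) by (auto simp: root_step_def)
    moreover have "2 * n - (2 * n - c') = c'" using c' by simp
    ultimately show ?thesis using 1 next_upper[of c'] c' by simp
  next
    case 2
    have "snd (row_point T c') = c'" "row_point T c' \<in> T" using row_point_in[of c'] c' by auto
    moreover have "root_step n T c c' = lower_row T c'" using c' assms(2,3) by (auto simp: root_step_def)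
    ultimately show ?thesis using 2 next_lower[of c'] c' by simp
  qed
  then show "next_point n T (c', r) \<in> T" "root_step n T c (snd (next_point n T (c', r))) = r" by auto
qed

lemma path_Suc: "path n T p (Suc k) = next_point n T (path n T p k)"
  by (simp add: path_def)

lemma path_in: "p \<in> T \<Longrightarrow> path n T p k \<in> T"
proof (induction k)
  case (Suc k)
  obtain c r where cr: "path n T p k = (c, r)" "(c, r) \<in> T" using Suc by (metis surj_pair)
  show ?case
  proof (cases "c = n")
    case True
    then show ?thesis using cr by (simp add: path_Suc next_point_def)
  next
    case False
    then have "c < n" using in_grid[OF cr(2)] by simp
    then show ?thesis using root_step_next(1)[OF cr(2), of n] cr(1) by (simp add: path_Suc)
  qed
qed (simp add: path_def)

text \<open>Read the root sequence from \<open>x\<close> to \<open>i\<close> backwards: by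
  \<open>root_step_back\<close> it is a path from row \<open>i\<close> whose points before row
  \<open>x\<close> all lie in columns before \<open>c\<close>.\<close>

lemma path_of_roots:
  assumes "c \<in> {1..n}" "x \<in> {1..2 * n}" "(root_step n T c ^^ k) x = i" "i \<in> src n c"
  shows "\<exists>k'. path n T (row_point T i) k' = row_point T x \<and> (\<forall>k''<k'. fst (path n T (row_point T i) k'') < c)"
  using assms
proof (induction k arbitrary: x)
  case 0
  then show ?case by (intro exI[of _ 0]) (simp add: path_def)
next
  case (Suc k)
  show ?case
  proof (cases "x \<in> src n c")
    case True
    then have "i = x" using Suc.prems(3) root_steps_fixed[OF True, of "Suc k"] by simp
    then show ?thesis by (intro exI[of _ 0]) (simp add: path_def)
  next
    case False
    obtain c' where c': "1 \<le> c'" "c' < c" "(c', root_step n T c x) \<in> T"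
      "next_point n T (c', root_step n T c x) = row_point T x" "root_step n T c x \<in> {1..2 * n}"
      using root_step_back[OF Suc.prems(2) False Suc.prems(1)] by blast
    have "(root_step n T c ^^ k) (root_step n T c x) = i" using Suc.prems(3) by (simp add: funpow_swap1)
    from Suc.IH[OF Suc.prems(1) c'(5) this Suc.prems(4)] obtain k'
      where k': "path n T (row_point T i) k' = (c', root_step n T c x)"
        "\<And>k''. k'' < k' \<Longrightarrow> fst (path n T (row_point T i) k'') < c"
      using row_point_eq[OF c'(3)] by auto
    show ?thesis
      using k' c'(2,4) by (intro exI[of _ "Suc k'"]) (auto simp: path_Suc less_Suc_eq)
  qed
qed

lemma roots_of_path:
  assumes "c \<le> n" "i \<in> {1..2 * n}" "\<And>k'. k' < k \<Longrightarrow> fst (path n T (row_point T i) k') < c"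
  shows "(root_step n T c ^^ k) (snd (path n T (row_point T i) k)) = i"
  using assms(3)
proof (induction k)
  case 0
  then show ?case using row_point_in[OF assms(2)] by (simp add: path_def)
next
  case (Suc k)
  let ?p = "path n T (row_point T i)"
  have "?p k \<in> T" using path_in row_point_in[OF assms(2)] by blast
  then have "root_step n T c (snd (?p (Suc k))) = snd (?p k)"
    using root_step_next(2)[of "fst (?p k)" "snd (?p k)" c] Suc.prems[of k] assms(1) by (simp add: path_Suc)
  then show ?case using Suc by (simp add: funpow_swap1)
qed

text \<open>The step maps for \<open>c\<close> and \<open>c + 1\<close> differ only at
  \<open>c\<close> and \<open>2n - c\<close>. Both lie in \<open>src n c\<close>, where the sequence
  for \<open>c\<close> has already stopped.\<close>

lemma root_steps_mono:
  assumes "1 \<le> c" "c < n" "(root_step n T c ^^ k) x = v" "v \<in> src n c"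
  shows "\<exists>k'. (root_step n T (Suc c) ^^ k') x = v"
  using assms(3)
proof (induction k arbitrary: x)
  case 0
  then show ?case by (intro exI[of _ 0]) simp
next
  case (Suc k)
  show ?case
  proof (cases "x \<in> src n c")
    case True
    then have "x = v" using Suc.prems root_steps_fixed[OF True, of "Suc k"] by simp
    then show ?thesis by (intro exI[of _ 0]) simp
  next
    case False
    then have "root_step n T (Suc c) x = root_step n T c x"
      using assms(1,2) by (auto simp: root_step_def src_def)
    moreover obtain k' where "(root_step n T (Suc c) ^^ k') (root_step n T c x) = v"
      using Suc.IH[of "root_step n T c x"] Suc.prems by (auto simp: funpow_swap1)
    ultimately show ?thesis by (intro exI[of _ "Suc k'"]) (simp add: funpow_swap1)
  qed
qed

text \<open>This ties the transpositions in \<open>source\<close> to the root sequence: the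
  induction on columns extends the sequence for \<open>c\<close> by the moves that become possible
  for \<open>c + 1\<close>.\<close>

lemma root_steps_col_source:
  assumes "c \<in> {1..n}" "x \<in> avail c"
  shows "\<exists>k. (root_step n T c ^^ k) x = col_source c x"
proof -
  define reach where "reach c x y \<longleftrightarrow> (\<exists>k. (root_step n T c ^^ k) x = y)" for c x y
  have trans: "reach c x z" if xyz: "reach c x y" "reach c y z" for c x y z
  proof -
    obtain k k' where "(root_step n T c ^^ k) x = y" "(root_step n T c ^^ k') y = z"
      using xyz by (auto simp: reach_def)
    then have "(root_step n T c ^^ (k' + k)) x = z" by (simp add: funpow_add)
    then show ?thesis unfolding reach_def by blast
  qed
  have one: "reach c x (root_step n T c x)" for c x unfolding reach_def by (rule exI[of _ 1]) simp
  have "reach (Suc m) x (col_source (Suc m) x)" if "m < n" "x \<in> avail (Suc m)" for m x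
    using that
  proof (induction m arbitrary: x)
    case 0
    then show ?case unfolding reach_def by (intro exI[of _ 0]) (simp add: col_source_def)
  next
    case (Suc m)
    define c where "c = Suc m"
    define r where "r = col_source c"
    define l u where "l = lower_row T c" and "u = upper_row T c"
    define r1 where "r1 = transpose c (r l) \<circ> r"
    define r2 where "r2 = transpose (2 * n - c) (r1 u) \<circ> r1"
    have c: "1 \<le> c" "c < n" "c \<in> {1..n}" using Suc.prems by (auto simp: c_def)
    have r2: "col_source (Suc c) = r2"
      unfolding r2_def r1_def r_def
      by (simp add: col_source_def c_def Let_def l_def u_def lower_row_eq upper_row_eq del: source.simps(1))
    note bij = col_source_bij[OF c(3), folded r_def]
    have lu: "l \<in> avail c" "u \<in> avail c" "l \<noteq> u"
      using in_avail lower_in[OF c(3)] upper_in[OF c(3)] col_eq(2)[OF c(3)] by (auto simp: l_def u_def)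
    have cd: "c \<in> src n c" "2 * n - c \<in> src n c" "c \<noteq> 2 * n - c"
      using c by (auto simp: src_def)
    note contract = contract_bij[OF bij lu cd, folded r1_def, folded r2_def]
    have av: "avail (Suc c) = avail c - {l, u}"
      using col_eq(1)[OF c(3)] by (auto simp: c_def l_def u_def)
    have x: "x \<in> avail c" "x \<noteq> l" "x \<noteq> u" using Suc.prems(2) av by (auto simp: c_def)
    have up: "reach (Suc c) z (r z)" if "z \<in> avail c" for z
    proof -
      have "reach c z (r z)" unfolding c_def r_def using Suc.IH[of z] Suc.prems(1) that by (simp add: c_def)
      moreover have "r z \<in> src n c" using bij that by (auto simp: bij_betw_def)
      ultimately show ?thesis unfolding reach_def using root_steps_mono[OF c(1,2)] by metis
    qed
    \<comment> \<open>For column \<open>c + 1\<close> the values \<open>c\<close> and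
      \<open>2n - c\<close> are no longer final but continue to the lower and upper row of column
      \<open>c\<close>.\<close>
    have "root_step n T (Suc c) c = l" "root_step n T (Suc c) (2 * n - c) = u"
      using c by (auto simp: root_step_def l_def u_def)
    then have cl: "reach (Suc c) c (r l)" and du: "reach (Suc c) (2 * n - c) u"
      using trans[OF one[of "Suc c" c]] up[OF lu(1)] one[of "Suc c" "2 * n - c"] by simp_all
    \<comment> \<open>If the old source is \<open>c\<close>, the sequence continues through row
      \<open>l\<close> to the source of \<open>l\<close>, as the first transposition
      prescribes.\<close>
    have to_r1: "reach (Suc c) z (r1 z)" if "z \<in> avail c" "z \<noteq> l" for z
      using contract(3)[OF that] up[OF that(1)] cl trans by (auto split: if_splits)
    \<comment> \<open>If the value is then \<open>2n - c\<close>, it continues through row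
      \<open>u\<close> to \<open>r1 u\<close>; using \<open>r1\<close> here covers the case that
      \<open>u\<close> itself had source \<open>c\<close>.\<close>
    have "reach (Suc c) x (r2 x)"
      using contract(4)[OF x] to_r1[OF x(1,2)] trans[OF du to_r1[of u]] lu trans[of "Suc c" x "2 * n - c" "r1 u"]
      by (auto split: if_splits)
    then have "reach (Suc c) x (col_source (Suc c) x)" by (simp only: r2)
    then show ?case by (simp only: c_def)
  qed
  from this[of "c - 1" x] show ?thesis using assms unfolding reach_def by auto
qed

lemma root_steps_unique:
  assumes "(root_step n T c ^^ k) x = v" "v \<in> src n c" "(root_step n T c ^^ k') x = v'" "v' \<in> src n c"
  shows "v = v'"
proof -
  have "(root_step n T c ^^ (k' + k)) x = v" "(root_step n T c ^^ (k + k')) x = v'"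
    using assms root_steps_fixed by (simp_all only: funpow_add o_apply)
  then show ?thesis by (simp add: add.commute)
qed

lemma root_of_eq:
  assumes "(c, x) \<in> T" shows "root_of n T (c, x) = col_source c x"
proof -
  have c: "c \<in> {1..n}" using in_grid[OF assms] by simp
  obtain k where k: "(root_step n T c ^^ k) x = col_source c x"
    using root_steps_col_source[OF c in_avail[OF assms]] by blast
  have v: "col_source c x \<in> src n c" using col_source_bij[OF c] in_avail[OF assms] by (auto simp: bij_betw_def)
  have ev: "(root_step n T c ^^ k') x = col_source c x" if "k' \<ge> k" for k'
  proof -
    have "(root_step n T c ^^ (k' - k + k)) x = col_source c x"
      using k root_steps_fixed[OF v] by (simp only: funpow_add o_apply)
    then show ?thesis using that by simp
  qed
  have "w = col_source c x" if "\<forall>k'\<ge>K. (root_step n T c ^^ k') x = w" for w K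
    using that ev[of "max k K"] by (metis max.cobounded1 max.cobounded2)
  then show ?thesis unfolding root_of_def using ev by (auto intro!: the_equality)
qed

section \<open>Points of B(T), R(T) and G(T), and free points\<close>

text \<open>For \<open>i = n\<close> and \<open>i = 2n\<close> these are the points of \<open>B(T)\<close> and \<open>R(T)\<close>.\<close>

definition sourced :: "nat \<Rightarrow> point set" where
  "sourced i = {(c, x) \<in> T. col_source c x = i}"

text \<open>A record in column \<open>c\<close> is preceded only by points in columns before
  \<open>c\<close>, which is exactly when the path can be read backwards as root steps for
  \<open>c\<close>. Since \<open>n\<close> and \<open>2n\<close> lie in every
  \<open>src n c\<close>, the starting row is then the root, and conversely.\<close>

lemma path_records:
  assumes "i \<in> {n, 2 * n}"
  defines "p \<equiv> path n T (row_point T i)"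
  shows "p ` {k. \<forall>k'<k. fst (p k') < fst (p k)} = sourced i"
proof -
  have i: "i \<in> {1..2 * n}" using assms n by auto
  have src: "i \<in> src n c" if "c \<in> {1..n}" for c using that assms n by (auto simp: src_def)
  have pT: "p k \<in> T" for k unfolding p_def using path_in row_point_in[OF i] by blast
  show ?thesis
  proof (intro equalityI subsetI)
    fix q assume "q \<in> p ` {k. \<forall>k'<k. fst (p k') < fst (p k)}"
    then obtain k where k': "q = p k" "\<forall>k'<k. fst (p k') < fst (p k)" by blast
    obtain c x where k: "p k = (c, x)" by (cases "p k")
    have less: "fst (p k') < c" if "k' < k" for k' using k'(2) that k by simp
    have cx: "(c, x) \<in> T" using pT[of k] k by simp
    have c: "c \<in> {1..n}" using in_grid[OF cx] by simp
    have "(root_step n T c ^^ k) (snd (p k)) = i"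
      unfolding p_def by (rule roots_of_path) (use c i less in \<open>simp_all add: p_def\<close>)
    then have 1: "(root_step n T c ^^ k) x = i" by (simp add: k)
    obtain j where 2: "(root_step n T c ^^ j) x = col_source c x"
      using root_steps_col_source[OF c in_avail[OF cx]] by blast
    have 3: "col_source c x \<in> src n c"
      using col_source_bij[OF c] in_avail[OF cx] by (auto simp: bij_betw_def)
    have "col_source c x = i" by (rule root_steps_unique[OF 2 3 1 src[OF c]])
    then show "q \<in> sourced i" using cx k k'(1) by (simp add: sourced_def)
  next
    fix q assume "q \<in> sourced i"
    then obtain c x where q: "q = (c, x)" "(c, x) \<in> T" "col_source c x = i" by (auto simp: sourced_def)
    have c: "c \<in> {1..n}" "x \<in> {1..2 * n}" using in_grid[OF q(2)] by auto
    obtain k where "(root_step n T c ^^ k) x = i"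
      using root_steps_col_source[OF c(1) in_avail[OF q(2)]] q(3) by blast
    from path_of_roots[OF c this src[OF c(1)]] obtain k' where
      k': "p k' = row_point T x" "\<forall>k''<k'. fst (p k'') < c" unfolding p_def by blast
    have "p k' = (c, x)" using k'(1) row_point_eq[OF q(2)] by simp
    with k'(2) show "q \<in> p ` {k. \<forall>k'<k. fst (p k') < fst (p k)}"
      using q(1) by (intro image_eqI[of _ _ k']) auto
  qed
qed

text \<open>Distinct records lie in distinct columns, so the list has no repeated points and its
  length is a cardinality.\<close>

lemma S_seq_sourced:
  assumes "i \<in> {n, 2 * n}"
  shows "set (S_seq n T i) = sourced i" "length (S_seq n T i) = card (sourced i)"
proof -
  define p where "p = path n T (row_point T i)"
  define R where "R = {k. \<forall>k'<k. fst (p k') < fst (p k)}"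
  have i: "i \<in> {1..2 * n}" using assms n by auto
  have pT: "p k \<in> T" for k unfolding p_def using path_in row_point_in[OF i] by blast
  have bij: "bij_betw (record_index p) {..last_record p} R" unfolding R_def
  proof (rule record_index_bij)
    show "fst (p k) \<le> n" for k using in_grid[of "fst (p k)" "snd (p k)"] pT[of k] by simp
  qed
  have S: "S_seq n T i = map (\<lambda>q. p (record_index p q)) [0..<Suc (last_record p)]"
    by (simp add: S_seq_def Let_def p_def)
  have img: "p ` R = sourced i" unfolding R_def p_def by (rule path_records[OF assms])
  have "set (S_seq n T i) = p ` record_index p ` {..last_record p}"
    unfolding S by (simp add: image_image atLeast0LessThan lessThan_Suc_atMost del: upt_Suc)
  also have "record_index p ` {..last_record p} = R" using bij by (simp add: bij_betw_def)
  finally show "set (S_seq n T i) = sourced i" using img by simp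
  have "inj_on p R"
  proof (rule inj_onI)
    fix k k' assume "k \<in> R" "k' \<in> R" "p k = p k'"
    then show "k = k'" by (cases k k' rule: linorder_cases) (auto simp: R_def)
  qed
  then have "card (sourced i) = card R" unfolding img[symmetric] by (rule card_image)
  also have "\<dots> = Suc (last_record p)" using bij_betw_same_card[OF bij] by simp
  finally show "length (S_seq n T i) = card (sourced i)" by (simp add: S)
qed

text \<open>Each column has at most one point with a given source. The last column has exactly the
  sources \<open>n\<close> and \<open>2n\<close>; it accounts for the \<open>Suc\<close> that the
  definitions of b and r subtract.\<close>

lemma card_sourced:
  assumes "i \<in> {n, 2 * n}"
  shows "card (sourced i) = Suc (\<Sum>c=1..n - 1. of_bool (i \<in> col_source c ` col T c))"
proof -
  let ?C = "{c \<in> {1..n}. i \<in> col_source c ` col T c}"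
  have "bij_betw fst (sourced i) ?C"
    unfolding bij_betw_def
  proof
    show "inj_on fst (sourced i)"
      by (auto simp: inj_on_def sourced_def dest: col_source_inj)
    show "fst ` sourced i = ?C"
    proof (intro equalityI subsetI)
      fix c assume "c \<in> fst ` sourced i"
      then obtain x where "(c, x) \<in> T" "col_source c x = i" by (auto simp: sourced_def)
      then show "c \<in> ?C" using in_grid[of c x] by (auto simp: col_def)
    next
      fix c assume "c \<in> ?C"
      then obtain x where "(c, x) \<in> T" "col_source c x = i" by (auto simp: col_def)
      then have "(c, x) \<in> sourced i" by (simp add: sourced_def)
      then show "c \<in> fst ` sourced i" by (rule rev_image_eqI) simp
    qed
  qed
  then have "card (sourced i) = card ?C" by (rule bij_betw_same_card)
  moreover have "n \<in> ?C"
  proof -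
    have "col_source n ` col T n = src n n"
      using col_source_bij[of n] n unfolding last_col by (simp add: bij_betw_def)
    then show ?thesis using assms n by (auto simp: src_def)
  qed
  then have "?C = insert n {c \<in> {1..n - 1}. i \<in> col_source c ` col T c}" using n by auto
  moreover have "n \<notin> {c \<in> {1..n - 1}. i \<in> col_source c ` col T c}" using n by auto
  moreover have "(\<Sum>c=1..n - 1. of_bool (i \<in> col_source c ` col T c)) = card {c \<in> {1..n - 1}. i \<in> col_source c ` col T c}"
    by (simp add: of_bool_def sum.inter_filter[symmetric] Collect_conj_eq)
  ultimately show ?thesis by simp
qed

text \<open>Let a point of column \<open>c < n\<close> have source \<open>c\<close>. If it is not in
  row \<open>c\<close>, its row is not a source, since it would be its own source; so the row
  exceeds \<open>2n - c\<close> and the point is free. In column \<open>n\<close> both points would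
  need source \<open>n\<close>, which is impossible.\<close>

lemma G_points_eq:
  "G_points n T = {(c, i) \<in> T. c < n \<and> col_source c ` col T c = {n, c} \<and> i \<noteq> c \<and> col_source c i = c}"
proof -
  have "(c, i) \<in> G_points n T \<longleftrightarrow>
      c < n \<and> col_source c ` col T c = {n, c} \<and> i \<noteq> c \<and> col_source c i = c" if ci: "(c, i) \<in> T" for c i
  proof -
    have c: "c \<in> {1..n}" using in_grid[OF ci] by simp
    have free: "i \<ge> 2 * n + 1 - c \<longleftrightarrow> i \<noteq> c" if "col_source c i = c" "c < n"
    proof
      assume "i \<noteq> c"
      then have "i \<notin> src n c" using col_source_fixed[OF c _ in_avail[OF ci]] that by auto
      then show "i \<ge> 2 * n + 1 - c" using in_grid[OF ci] by (auto simp: src_def)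
    qed (use that in_grid[OF ci] in auto)
    have B: "(c, i') \<in> set (B_seq n T) \<longleftrightarrow> (c, i') \<in> T \<and> col_source c i' = n" for i'
      using S_seq_sourced(1)[of n] by (simp add: B_seq_def sourced_def)
    have G: "(c, i) \<in> G_points n T \<longleftrightarrow> i \<ge> 2 * n + 1 - c \<and> (\<exists>i'. i' \<noteq> i \<and> (c, i') \<in> T \<and> col_source c i' = n)
        \<and> col_source c i = c"
      using ci root_of_eq[OF ci] B by (auto simp: G_points_def free_points_def)
    have "c < n" if "(c, i) \<in> G_points n T"
    proof (rule ccontr)
      assume "\<not> c < n"
      then have "c = n" using c by simp
      then show False using that G col_source_inj[OF ci] by auto
    qed
    moreover have "(\<exists>i'. i' \<noteq> i \<and> (c, i') \<in> T \<and> col_source c i' = n) \<longleftrightarrow> col_source c ` col T c = {n, c}"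
      if "col_source c i = c" "c < n"
    proof
      assume "\<exists>i'. i' \<noteq> i \<and> (c, i') \<in> T \<and> col_source c i' = n"
      then obtain i' where i': "i' \<noteq> i" "(c, i') \<in> T" "col_source c i' = n" by blast
      have "col T c = {i', i}"
        using col_eq(1)[OF c] i' ci by (auto simp: col_def doubleton_eq_iff set_eq_iff)
      then show "col_source c ` col T c = {n, c}" using i' that by simp
    next
      assume "col_source c ` col T c = {n, c}"
      then obtain i' where "i' \<in> col T c" "col_source c i' = n" by (metis imageE insertI1)
      then show "\<exists>i'. i' \<noteq> i \<and> (c, i') \<in> T \<and> col_source c i' = n"
        using that by (intro exI[of _ i']) (auto simp: col_def)
    qed
    ultimately show ?thesis using G free by blast
  qed
  moreover have "G_points n T \<subseteq> T" by (auto simp: G_points_def free_points_def)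
  ultimately show ?thesis by auto
qed

lemma g_stat_eq:
  "g_stat n T = (\<Sum>c=1..n - 1. of_bool (col_source c ` col T c = {n, c} \<and> c \<in> \<Union> (set (cols T (c - 1)))))"
proof -
  let ?C = "{c \<in> {1..n - 1}. col_source c ` col T c = {n, c} \<and> c \<in> \<Union> (set (cols T (c - 1)))}"
  have "bij_betw fst (G_points n T) ?C"
    unfolding bij_betw_def
  proof
    show "inj_on fst (G_points n T)"
      unfolding G_points_eq by (auto simp: inj_on_def dest: col_source_inj)
    show "fst ` G_points n T = ?C"
    proof (intro equalityI subsetI)
      fix c assume "c \<in> fst ` G_points n T"
      then obtain i where i: "(c, i) \<in> T" "c < n" "col_source c ` col T c = {n, c}" "i \<noteq> c" "col_source c i = c"
        unfolding G_points_eq by auto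
      have c: "c \<in> {1..n}" using in_grid[OF i(1)] by simp
      have "c \<notin> avail c"
      proof
        assume a: "c \<in> avail c"
        have "c \<in> src n c" using c by (auto simp: src_def)
        then have "col_source c c = col_source c i" using col_source_fixed[OF c _ a] i(5) by simp
        then show False using col_source_bij[OF c] a in_avail[OF i(1)] i(4) by (auto simp: bij_betw_def inj_on_def)
      qed
      then show "c \<in> ?C" using i c by auto
    next
      fix c assume C: "c \<in> ?C"
      then have "c \<in> col_source c ` col T c" by auto
      then obtain i where i: "(c, i) \<in> T" "col_source c i = c" by (auto simp: col_def)
      have "i \<noteq> c" using in_avail[OF i(1)] C by auto
      then have "(c, i) \<in> G_points n T" unfolding G_points_eq using i C n by auto
      then show "c \<in> fst ` G_points n T" by (rule rev_image_eqI) simp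
    qed
  qed
  then have "g_stat n T = card ?C" unfolding g_stat_def by (rule bij_betw_same_card)
  then show ?thesis by (simp add: of_bool_def sum.inter_filter[symmetric] Collect_conj_eq)
qed

text \<open>Count free points by rows: the point in row \<open>2n - d\<close> is free iff its column
  exceeds \<open>d\<close>, i.e. iff no column up to \<open>d\<close> uses that row. The case
  \<open>d = 0\<close> always holds and gives the \<open>Suc\<close>.\<close>

lemma fr_stat_eq:
  "fr_stat n T = Suc (card {c \<in> {1..n - 1}. 2 * n - c \<notin> \<Union> (set (cols T c))})"
proof -
  let ?C = "{c \<in> {1..n - 1}. 2 * n - c \<notin> \<Union> (set (cols T c))}"
  have "inj_on snd (free_points n T)"
  proof (rule inj_onI)
    fix p q assume "p \<in> free_points n T" "q \<in> free_points n T" "snd p = snd q"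
    then show "p = q" using row_unique[of "fst p" "snd p" "fst q"] by (auto simp: free_points_def)
  qed
  then have "fr_stat n T = card (snd ` free_points n T)" by (simp add: fr_stat_def card_image)
  also have "snd ` free_points n T = insert (2 * n) ((\<lambda>c. 2 * n - c) ` ?C)"
  proof (intro equalityI subsetI)
    fix i assume "i \<in> snd ` free_points n T"
    then obtain c where c: "(c, i) \<in> T" "i \<ge> 2 * n + 1 - c" by (auto simp: free_points_def)
    have ci: "c \<in> {1..n}" "i \<le> 2 * n" using in_grid[OF c(1)] by auto
    show "i \<in> insert (2 * n) ((\<lambda>c. 2 * n - c) ` ?C)"
    proof (cases "i = 2 * n")
      case False
      have i: "2 * n - (2 * n - i) = i" using ci by simp
      have "i \<notin> \<Union> (set (cols T (2 * n - i)))"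
      proof
        assume "i \<in> \<Union> (set (cols T (2 * n - i)))"
        then obtain d where "d \<le> 2 * n - i" "(d, i) \<in> T" by (auto simp: Union_cols)
        then show False using row_unique[OF c(1)] c(2) ci by auto
      qed
      moreover have "2 * n - i \<in> {1..n - 1}" using c(2) ci False by auto
      ultimately have "2 * n - i \<in> ?C" using i by simp
      then have "i \<in> (\<lambda>c. 2 * n - c) ` ?C" by (rule rev_image_eqI) (use i in simp)
      then show ?thesis by (rule insertI2)
    qed simp
  next
    fix i assume i: "i \<in> insert (2 * n) ((\<lambda>c. 2 * n - c) ` ?C)"
    then have "i \<in> {1..2 * n}" using n by auto
    then obtain c where c: "(c, i) \<in> T" using row_ex by blast
    have "i \<ge> 2 * n + 1 - c"
    proof (cases "i = 2 * n")
      case True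
      then show ?thesis using in_grid[OF c] by auto
    next
      case False
      then obtain d where d: "i = 2 * n - d" "d \<in> {1..n - 1}" "2 * n - d \<notin> \<Union> (set (cols T d))"
        using i False by blast
      then have "c \<notin> {1..d}" using c by (auto simp: Union_cols)
      then have "d < c" using in_grid[OF c] by simp
      then show ?thesis using d(1,2) by simp
    qed
    then have "(c, i) \<in> free_points n T" using c by (simp add: free_points_def)
    then show "i \<in> snd ` free_points n T" by (rule rev_image_eqI) simp
  qed
  also have "card \<dots> = Suc (card ((\<lambda>c. 2 * n - c) ` ?C))"
  proof (rule card_insert_disjoint)
    show "2 * n \<notin> (\<lambda>c. 2 * n - c) ` ?C" using n by auto
  qed simp
  also have "card ((\<lambda>c. 2 * n - c) ` ?C) = card ?C"
    by (rule card_image) (auto simp: inj_on_def)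
  finally show ?thesis .
qed

section \<open>The weight of an encoded placement\<close>

definition max_at :: "nat \<Rightarrow> nat" where
  "max_at c = of_bool (n \<in> col_source c ` col T c) + of_bool (2 * n \<in> col_source c ` col T c)
      + of_bool (col_source c ` col T c = {n, c} \<and> c \<in> \<Union> (set (cols T (c - 1))))"

text \<open>The weight asks whether \<open>c\<close> and \<open>2n - c\<close> were picked as
  sources, the statistics whether they were used as rows. Both values lie in \<open>src n c\<close>,
  where \<open>encode_used\<close> and \<open>encode_bij\<close> identify the two questions.\<close>

lemma wt_encode_cols:
  assumes "m < n"
  shows "wt n y (encode n (cols T m)) =
    2 ^ card {c \<in> {1..m}. 2 * n - c \<notin> \<Union> (set (cols T c))} * y ^ (\<Sum>c=1..m. max_at c)"
  using assms
proof (induction m)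
  case (Suc m)
  let ?zs = "cols T m" and ?q = "col T (Suc m)"
  have zs: "?zs \<in> row_codes n m" using cols_in_row_codes[of m] Suc.prems by simp
  have q: "?q \<subseteq> {1..2 * n} - \<Union> (set ?zs)" using col_subset[of "Suc m"] Suc.prems by simp
  have used: "v \<in> \<Union> (set (encode n ?zs)) \<longleftrightarrow> v \<in> \<Union> (set ?zs)"
    "v \<in> source n ?zs ` ?q \<union> \<Union> (set (encode n ?zs)) \<longleftrightarrow> v \<in> ?q \<union> \<Union> (set ?zs)"
    if "v \<in> src n (Suc m)" for v
  proof -
    show *: "v \<in> \<Union> (set (encode n ?zs)) \<longleftrightarrow> v \<in> \<Union> (set ?zs)"
      by (rule encode_bij(2)[OF _ zs that]) (use Suc.prems in simp)
    show "v \<in> source n ?zs ` ?q \<union> \<Union> (set (encode n ?zs)) \<longleftrightarrow> v \<in> ?q \<union> \<Union> (set ?zs)"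
      by (rule encode_used[OF zs _ q that *]) (use Suc.prems in simp)
  qed
  have len: "length (encode n zs) = length zs" for zs by (induction zs) auto
  have src: "Suc m \<in> src n (Suc m)" "2 * n - Suc m \<in> src n (Suc m)" using Suc.prems by (auto simp: src_def)
  have C: "{c \<in> {1..Suc m}. 2 * n - c \<notin> \<Union> (set (cols T c))} =
    (if 2 * n - Suc m \<in> ?q \<union> \<Union> (set ?zs) then {} else {Suc m}) \<union> {c \<in> {1..m}. 2 * n - c \<notin> \<Union> (set (cols T c))}"
    by (auto simp: atLeastAtMostSuc_conv)
  have card: "card {c \<in> {1..Suc m}. 2 * n - c \<notin> \<Union> (set (cols T c))} =
    (if 2 * n - Suc m \<in> ?q \<union> \<Union> (set ?zs) then 0 else 1) + card {c \<in> {1..m}. 2 * n - c \<notin> \<Union> (set (cols T c))}"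
    unfolding C by (subst card_Un_disjoint) auto
  have "wt n y (encode n (cols T (Suc m))) = wt n y (encode n ?zs)
     * ((if 2 * n - Suc m \<in> ?q \<union> \<Union> (set ?zs) then 1 else 2)
        * y ^ max_at (Suc m))"
    unfolding cols.simps encode.simps wt.simps len length_cols col_stat_def used(1)[OF src(1)] used(2)[OF src(2)]
      max_at_def col_source_def diff_Suc_1 ..
  moreover have "wt n y (encode n ?zs)
      = 2 ^ card {c \<in> {1..m}. 2 * n - c \<notin> \<Union> (set (cols T c))} * y ^ (\<Sum>c=1..m. max_at c)"
    by (rule Suc.IH) (use Suc.prems in simp)
  moreover have "(\<Sum>c=1..Suc m. max_at c) = (\<Sum>c=1..m. max_at c) + max_at (Suc m)" by simp
  ultimately show ?case unfolding card
    by (cases "2 * n - Suc m \<in> ?q \<union> \<Union> (set ?zs)")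
      (simp_all only: if_True if_False power_add power_0 power_one_right mult_1_left mult_ac)
qed simp

lemma max_stat_eq: "max_stat n T = (\<Sum>c=1..n - 1. max_at c)"
proof -
  have "length (S_seq n T i) - 1 = (\<Sum>c=1..n - 1. of_bool (i \<in> col_source c ` col T c))" if "i \<in> {n, 2 * n}" for i
    using S_seq_sourced(2)[OF that] card_sourced[OF that] by simp
  from this[of n] this[of "2 * n"] show ?thesis
    unfolding max_stat_def b_stat_def r_stat_def g_stat_eq B_seq_def R_seq_def max_at_def sum.distrib
    by (simp only: insert_iff simp_thms)
qed

lemma wt_placement: "wt n y (encode n (cols T (n - 1))) = 2 ^ (fr_stat n T - 1) * y ^ max_stat n T"
  using wt_encode_cols[of "n - 1" y] n by (simp add: fr_stat_eq max_stat_eq)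

end

theorem theorem1:
  fixes n :: nat
  assumes "n \<ge> 1"
  shows "P_poly n = (\<Sum>T\<in>placements n.
    monom (2 powi (int (fr_stat n T) - 1 - int (max_stat n T))) (max_stat n T))"
proof -
  \<comment> \<open>Over the infinite field of rationals it suffices to compare values.\<close>
  have "poly (P_poly n) = poly (\<Sum>T\<in>placements n.
    monom (2 powi (int (fr_stat n T) - 1 - int (max_stat n T))) (max_stat n T))"
  proof
    fix x :: rat
    define y where "y = x / 2"
    have "poly (P_poly n) x = code_sum n (n - 1) y"
    proof -
      have n: "n - 1 < n" "Suc (n - 1) = n" "n - (n - 1) - 1 = 0" using assms by auto
      show ?thesis unfolding code_sum_eq_poly[OF n(1)] n(2,3) by (simp add: y_def)
    qed
    also have "\<dots> = (\<Sum>zs\<in>row_codes n (n - 1). wt n y (encode n zs))"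
    proof -
      have "n - 1 < n" using assms by simp
      from sum.reindex_bij_betw[OF encode_bij(1)[OF this], of "wt n y"] show ?thesis
        unfolding code_sum_def by (rule sym)
    qed
    also have "\<dots> = (\<Sum>T\<in>placements n. wt n y (encode n (cols T (n - 1))))"
      by (rule sum.reindex_bij_betw[OF cols_bij[OF assms], of "\<lambda>zs. wt n y (encode n zs)", symmetric])
    also have "\<dots> = (\<Sum>T\<in>placements n.
        2 powi (int (fr_stat n T) - 1 - int (max_stat n T)) * x ^ max_stat n T)"
    proof (rule sum.cong[OF refl])
      fix T assume "T \<in> placements n"
      then interpret placement n T using assms by (simp add: placement_def)
      \<comment> \<open>The point in row \<open>2n\<close> is always free, so the natural
        subtraction in \<open>wt_placement\<close> does not truncate and agrees with the integer
        exponent.\<close>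
      have "fr_stat n T \<ge> 1" by (simp add: fr_stat_eq)
      then have fr: "int (fr_stat n T) - 1 = int (fr_stat n T - 1)" by linarith
      have "(2 :: rat) powi (int (fr_stat n T) - 1 - int (max_stat n T))
          = 2 powi int (fr_stat n T - 1) / 2 powi int (max_stat n T)"
        unfolding fr by (rule power_int_diff) simp
      then have "(2 :: rat) powi (int (fr_stat n T) - 1 - int (max_stat n T))
          = 2 ^ (fr_stat n T - 1) / 2 ^ max_stat n T"
        by (simp only: power_int_of_nat)
      then show "wt n y (encode n (cols T (n - 1)))
          = 2 powi (int (fr_stat n T) - 1 - int (max_stat n T)) * x ^ max_stat n T"
        unfolding wt_placement y_def power_divide by simp
    qed
    finally show "poly (P_poly n) x = poly (\<Sum>T\<in>placements n.
      monom (2 powi (int (fr_stat n T) - 1 - int (max_stat n T))) (max_stat n T)) x"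
      by (simp add: poly_sum poly_monom)
  qed
  then show ?thesis by (simp only: poly_eq_poly_eq_iff)
qed

end
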